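(* For every even integer $k\ge 0$ the inverse of $\Gamma:(x_{k+1},-k)\cup(-k,x_k)\to(-\infty,\Gamma(x_{k+1}))\cup(\Gamma(x_k),\infty)$ has a holomorphic extension $e_k$ to $\mathbb C\setminus[\Gamma(x_{k+1}),\Gamma(x_k)]$ with the representation $$e_k(z)=\int_{\Gamma(x_{k+1})}^{\Gamma(x_k)}\frac{d_k(-t)}{z-t}\,dt-k,\qquad z\in\mathbb C\setminus[\Gamma(x_{k+1}),\Gamma(x_k)],$$ where $d_k(s)=\frac1\pi\,\Im g_k(s+i0)$ for $s\in[-\Gamma(x_k),-\Gamma(x_{k+1})]\setminus\{0\}$. (The imaginary part of $e_k$ is negative in the upper half plane.)
   Context: $\mathbb C_+$ is the open upper half plane, $\Gamma$ is Euler's gamma function and $\gamma$ Euler's constant. For $k\ge 1$, $x_k$ denotes the unique zero of $\Gamma'$ in $(-k,-k+1)$, and $x_0$ denotes the unique zero of $\Gamma'$ in $(0,\infty)$. One has $\Gamma(x_k)<0$ for $k$ odd and $\Gamma(x_k)>0$ for $k$ even. For even $k\ge0$, $\Gamma$ is decreasing on each of $(x_{k+1},-k)$ and $(-k,x_k)$, and is a bijection from the union of these intervals onto $(-\infty,\Gamma(x_{k+1}))\cup(\Gamma(x_k),\infty)$. The function $\log\Gamma(z)=-\gamma z-\log z-\sum_{j=1}^\infty\left(\log(1+z/j)-z/j\right)$ (principal logarithms) is holomorphic in $\mathbb C\setminus(-\infty,0]$, and it maps $\mathbb C_+$ conformally (bijectively) onto the domain $\mathcal V=\mathbb C\setminus\bigcup_{k=0}^\infty\{x-ik\pi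 : x\ge\log|\Gamma(x_k)|\}$. $(\log\Gamma)^{-1}:\mathcal V\to\mathbb C_+$ denotes the inverse of this conformal map. For $k\in\mathbb Z$ put $g_k(z)=(\log\Gamma)^{-1}(\log z-i(k+1)\pi)$ for $z\in\mathbb C_+$, and $g_k(s+i0)=\lim_{y\to0+}g_k(s+iy)$. *)

theory Defs
  imports "HOL-Analysis.Analysis"
begin

definition gamma_crit :: "nat \<Rightarrow> real" where
  "gamma_crit k =
     (if k = 0 then (THE x. x > 0 \<and> deriv Gamma x = 0)
      else (THE x. - real k < x \<and> x < - real k + 1 \<and> deriv Gamma x = 0))"

definition upper_half_plane :: "complex set" where
  "upper_half_plane = {z. Im z > 0}"

text \<open>
  The branch of log Gamma on the plane cut along the nonpositive reals is \<open>ln_Gamma\<close>;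
  the following lemma is the series representation usually taken as its definition.
\<close>

lemma ln_Gamma_complex_series:
  fixes z :: complex
  assumes "z \<notin> \<int>\<^sub>\<le>\<^sub>0"
  shows "summable (\<lambda>j. ln (1 + z / of_nat (Suc j)) - z / of_nat (Suc j))"
    and "ln_Gamma z = - euler_mascheroni * z - ln z
           - (\<Sum>j. ln (1 + z / of_nat (Suc j)) - z / of_nat (Suc j))"
proof -
  have "(\<lambda>j. ln (1 + z / of_nat (Suc j)) - z / of_nat (Suc j)) sums
          - (ln_Gamma z + euler_mascheroni * z + ln z)"
    using sums_minus[OF ln_Gamma_series'_aux[OF assms]] by (simp only: minus_diff_eq)
  then show "summable (\<lambda>j. ln (1 + z / of_nat (Suc j)) - z / of_nat (Suc j))"
    and "ln_Gamma z = - euler_mascheroni * z - ln z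
           - (\<Sum>j. ln (1 + z / of_nat (Suc j)) - z / of_nat (Suc j))"
    by (auto simp: sums_iff)
qed

text \<open>
  \<open>ln_Gamma\<close> maps the upper half plane bijectively onto the plane minus the slits
  \<open>{x - \<i> k \<pi> | x \<ge> ln \<bar>Gamma (gamma_crit k)\<bar>}\<close>, \<open>k \<ge> 0\<close>; the function below is the inverse
  of that map and has no meaning on the slits.
\<close>

definition ln_Gamma_inv :: "complex \<Rightarrow> complex" where
  "ln_Gamma_inv = inv_into upper_half_plane ln_Gamma"

text \<open>Only used for \<open>z\<close> in the upper half plane.\<close>

definition gamma_branch :: "int \<Rightarrow> complex \<Rightarrow> complex" where
  "gamma_branch k z = ln_Gamma_inv (ln z - \<i> * (of_int k + 1) * of_real pi)"

definition gamma_branch_bdry :: "int \<Rightarrow> real \<Rightarrow> complex" where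
  "gamma_branch_bdry k s = Lim (at_right 0) (\<lambda>y. gamma_branch k (Complex s y))"

definition gamma_density :: "int \<Rightarrow> real \<Rightarrow> real" where
  "gamma_density k s = Im (gamma_branch_bdry k s) / pi"

end

(*
  ln_Gamma maps the upper half plane injectively (its derivative Digamma has positive imaginary part
  there) and properly over each closed horizontal strip, so by connectedness its image contains the
  open strip between two neighbouring slits together with the parts of the bounding lines in front of
  the slits.  Hence the branch g of the inverse that satisfies Gamma (g z) = - z is defined on the upper
  half plane, and the same properness gives the boundary values on [- b, - a].  For p between the
  critical points gamma_crit (k + 1) and gamma_crit k the entire function rGamma has positive
  derivative, so g (z) is close to p when - 1 / z is close to rGamma p; p = - k gives g (z) --> - k at
  infinity, the other p give real boundary values outside [- b, - a].  Shifting the argument until Gamma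
  is under control yields g (z) = O (1 + |z| powr (- 1/2)), which makes the density integrable, and
  Cauchy's formula in the half plane then represents g (z) + k by the imaginary part of its boundary
  values.  The extension e is this integral; it is g (- z) in the lower half plane and the complex
  conjugate of that in the upper half plane.
*)

theory Submission
  imports Defs "HOL-Complex_Analysis.Complex_Analysis"
begin

section \<open>Digamma and ln_Gamma in the upper half plane\<close>

text \<open>The obstacle is the origin: \<open>Gamma\<close> has no zeros, so g (z) is unbounded as
  z tends to 0, and a pointwise boundary limit alone would not give an integrable density there. The
  exponent -1/2 comes from keeping two factors of the functional equation, which make |w|^2 |Gamma
  w| bounded along the relevant preimages at height at least 1. A single factor would only give
  |z|^(-1), which is not integrable at 0. Evenness of k enters twice: the shift by (k + 1) pi
  becomes the minus sign in Gamma (g z) = - z, and \<open>rGamma\<close> increases through its zero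
  at - k. The image of \<open>ln_Gamma\<close> is only shown to contain the points in front of the
  slits. This leaves open whether a slit tip is a value, so the boundary limits at the two end
  points of the support need a separate compactness argument.\<close>

lemma nonpos_Ints_imp_Im_eq_0: "z \<in> \<int>\<^sub>\<le>\<^sub>0 \<Longrightarrow> Im z = 0"
  by (auto elim!: nonpos_Ints_cases')

lemma not_nonpos_Int_of_Im_pos: "Im z > 0 \<Longrightarrow> z \<notin> \<int>\<^sub>\<le>\<^sub>0"
  using nonpos_Ints_imp_Im_eq_0 by fastforce

lemma not_nonpos_Real_of_Im_pos: "Im z > 0 \<Longrightarrow> z \<notin> \<real>\<^sub>\<le>\<^sub>0"
  by (auto simp: complex_nonpos_Reals_iff)

lemma open_upper_half_plane: "open upper_half_plane"
  unfolding upper_half_plane_def by (rule open_halfspace_Im_gt)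

lemma convex_upper_half_plane: "convex upper_half_plane"
  unfolding upper_half_plane_def by (rule convex_halfspace_Im_gt)

lemma Im_inverse_less_0: "Im z > 0 \<Longrightarrow> Im (inverse z) < 0"
  by (simp add: divide_neg_pos sum_power2_gt_zero_iff)

lemma Re_inverse_le:
  assumes "Re z > 0"
  shows "Re (inverse z) \<le> inverse (Re z)"
proof -
  have "Re z / ((Re z)\<^sup>2 + (Im z)\<^sup>2) \<le> Re z / (Re z)\<^sup>2"
    using assms by (intro divide_left_mono mult_pos_pos) (auto simp: sum_power2_gt_zero_iff)
  also have "\<dots> = inverse (Re z)"
    using assms by (simp add: power2_eq_square field_simps)
  finally show ?thesis by simp
qed

text \<open>In the limit formula for \<open>Digamma\<close> every term - 1 / (z + n) has positive
  imaginary part.\<close>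

lemma Im_Digamma_pos:
  assumes "Im z > 0"
  shows "Im (Digamma z) > 0"
proof -
  have z0: "z \<noteq> 0" using assms by auto
  have "(\<lambda>m. Im (of_real (ln (real m)) - (\<Sum>n<m. inverse (z + of_nat n)))) \<longlonglongrightarrow> Im (Digamma z)"
    by (intro tendsto_intros Digamma_LIMSEQ z0)
  \<comment> \<open>Retaining the term n = 0 as a fixed positive lower bound keeps the inequality
    strict in the limit.\<close>
  moreover have "\<forall>m\<ge>1. - Im (inverse z) \<le> Im (of_real (ln (real m)) - (\<Sum>n<m. inverse (z + of_nat n)))"
  proof (intro allI impI)
    fix m :: nat assume "1 \<le> m"
    have "(\<Sum>n<m. Im (inverse (z + of_nat n))) \<le> (\<Sum>n\<in>{0}. Im (inverse (z + of_nat n)))"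
    proof -
      have "0 \<le> - Im (inverse (z + of_nat n))" for n
        using Im_inverse_less_0[of "z + of_nat n"] assms by simp
      then show ?thesis
        using sum_mono2[of "{..<m}" "{0}" "\<lambda>n. - Im (inverse (z + of_nat n))"] \<open>1 \<le> m\<close>
        by (simp add: sum_negf del: complex_inverse inverse_complex.simps)
    qed
    then show "- Im (inverse z) \<le> Im (of_real (ln (real m)) - (\<Sum>n<m. inverse (z + of_nat n)))"
      by (simp del: complex_inverse)
  qed
  ultimately have "- Im (inverse z) \<le> Im (Digamma z)"
    by (blast intro: LIMSEQ_le_const)
  then show ?thesis using Im_inverse_less_0[OF assms] by linarith
qed

text \<open>Termwise comparison in the limit formula. It carries the positivity of
  \<open>Digamma\<close> on the real axis from 3/2 onwards over to vertical lines.\<close>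

lemma Re_Digamma_ge:
  assumes "Re z > 0"
  shows "Digamma (Re z) \<le> Re (Digamma z)"
proof (rule LIMSEQ_le)
  have z0: "z \<noteq> 0" "Re z \<noteq> 0" using assms by auto
  show "(\<lambda>m. Re (of_real (ln (real m)) - (\<Sum>n<m. inverse (z + of_nat n)))) \<longlonglongrightarrow> Re (Digamma z)"
    by (intro tendsto_intros Digamma_LIMSEQ z0)
  show "(\<lambda>m. ln (real m) - (\<Sum>n<m. inverse (Re z + of_nat n))) \<longlonglongrightarrow> Digamma (Re z)"
    using Digamma_LIMSEQ[OF z0(2)] by simp
  have "(\<Sum>n<m. Re (inverse (z + of_nat n))) \<le> (\<Sum>n<m. inverse (Re z + of_nat n))" for m
    by (intro sum_mono) (use Re_inverse_le[of "z + of_nat _"] assms in auto)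
  then show "\<exists>N. \<forall>m\<ge>N. ln (real m) - (\<Sum>n<m. inverse (Re z + of_nat n))
      \<le> Re (of_real (ln (real m)) - (\<Sum>n<m. inverse (z + of_nat n)))"
    by auto
qed

lemma has_field_derivative_ln_Gamma_Im_pos:
  "Im z > 0 \<Longrightarrow> (ln_Gamma has_field_derivative Digamma z) (at z within A)"
  by (rule has_field_derivative_at_within[OF has_field_derivative_ln_Gamma_complex])
     (rule not_nonpos_Real_of_Im_pos)

lemma holomorphic_on_ln_Gamma_upper_half_plane: "ln_Gamma holomorphic_on upper_half_plane"
  by (rule holomorphic_ln_Gamma) (auto simp: upper_half_plane_def complex_nonpos_Reals_iff)

text \<open>This is the Noshiro--Warschawski criterion, rotated by a right angle.\<close>

lemma inj_on_of_Im_deriv_pos: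
  assumes "convex S" "\<And>z. z \<in> S \<Longrightarrow> (f has_field_derivative f' z) (at z within S)"
    and "\<And>z. z \<in> S \<Longrightarrow> Im (f' z) > 0"
  shows "inj_on f S"
proof (rule inj_onI, rule ccontr)
  fix x y assume xy: "x \<in> S" "y \<in> S" "f x = f y" "x \<noteq> y"
  define p where "p = (\<lambda>t::real. x + of_real t * (y - x))"
  define g where "g = (\<lambda>t. Im (f (p t) / (y - x)))"
  have pS: "p t \<in> S" if "t \<in> {0..1}" for t
    using convexD_alt[OF assms(1) xy(1,2), of t] that
    by (simp add: p_def scaleR_conv_of_real algebra_simps)
  have "(g has_vector_derivative Im (f' (p t))) (at t within {0..1})" if t: "t \<in> {0..1}" for t
  proof -
    have "(p has_vector_derivative (y - x)) (at t within {0..1})"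
      unfolding p_def by (auto intro!: derivative_eq_intros)
    then have "((f \<circ> p) has_vector_derivative (y - x) * f' (p t)) (at t within {0..1})"
      by (rule field_vector_diff_chain_within)
         (rule DERIV_subset[OF assms(2)[OF pS[OF t]]], use pS in auto)
    then have "((\<lambda>t. f (p t) / (y - x)) has_vector_derivative ((y - x) * f' (p t)) / (y - x)) (at t within {0..1})"
      unfolding o_def by (rule has_vector_derivative_divide)
    then have "((\<lambda>t. f (p t) / (y - x)) has_vector_derivative f' (p t)) (at t within {0..1})"
      using xy(4) by simp
    then show ?thesis
      unfolding g_def by (rule bounded_linear.has_vector_derivative[OF bounded_linear_Im])
  qed
  then have "\<forall>t\<in>{0..1}. (g has_derivative (\<lambda>h. h * Im (f' (p t)))) (at t within {0..1})"
    by (simp add: has_vector_derivative_def)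
  then obtain t where "t \<in> {0<..<1}" "g 1 - g 0 = (1 - 0) * Im (f' (p t))"
    using mvt_simple[of 0 1 g "\<lambda>t h. h * Im (f' (p t))"] by (meson atLeastAtMost_iff zero_less_one)
  moreover have "g 1 = g 0" using xy by (simp add: g_def p_def)
  ultimately show False using assms(3)[OF pS[of t]] by auto
qed

lemma inj_on_ln_Gamma: "inj_on ln_Gamma upper_half_plane"
  by (rule inj_on_of_Im_deriv_pos[OF convex_upper_half_plane has_field_derivative_ln_Gamma_Im_pos])
     (auto simp: upper_half_plane_def Im_Digamma_pos)

text \<open>The horizontal derivative is Im \<open>Digamma\<close>. The monotonicity serves to bound
  values in a horizontal strip by those on the line Re w = 1.\<close>

lemma Im_ln_Gamma_mono:
  assumes "x \<le> y" "v > 0"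
  shows "Im (ln_Gamma (Complex x v)) \<le> Im (ln_Gamma (Complex y v))"
proof (rule DERIV_nonneg_imp_nondecreasing[OF assms(1)])
  fix u
  have "((\<lambda>u. Im (ln_Gamma (of_real u + \<i> * of_real v))) has_vector_derivative
      Im (1 * Digamma (of_real u + \<i> * of_real v))) (at u)"
    by (intro bounded_linear.has_vector_derivative[OF bounded_linear_Im]
        field_vector_diff_chain_at[where g = ln_Gamma, unfolded o_def]
        has_field_derivative_ln_Gamma_Im_pos derivative_eq_intros refl | use assms in simp)+
  moreover have "Im (Digamma (of_real u + \<i> * of_real v)) > 0"
    by (rule Im_Digamma_pos) (use assms in auto)
  ultimately show "\<exists>y. ((\<lambda>u. Im (ln_Gamma (Complex u v))) has_real_derivative y) (at u) \<and> 0 \<le> y"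
    by (auto simp: Complex_eq has_real_derivative_iff_has_vector_derivative intro!: less_imp_le)
qed

text \<open>The vertical derivative of Im \<open>ln_Gamma\<close> is Re \<open>Digamma\<close>,
  which is positive here, and \<open>ln_Gamma\<close> is real on the positive axis. Hence preimages
  of points with nonpositive imaginary part satisfy Re z < 3/2.\<close>

lemma Im_ln_Gamma_pos:
  assumes "Re z \<ge> 3/2" "Im z > 0"
  shows "Im (ln_Gamma z) > 0"
proof -
  define u where "u = Re z"
  have "\<exists>y. ((\<lambda>v. Im (ln_Gamma (of_real u + \<i> * of_real v))) has_real_derivative y) (at v) \<and> 0 < y"
    if "0 \<le> v" for v
  proof -
    have "((\<lambda>v. Im (ln_Gamma (of_real u + \<i> * of_real v))) has_vector_derivative
        Im (\<i> * Digamma (of_real u + \<i> * of_real v))) (at v)"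
      by (intro bounded_linear.has_vector_derivative[OF bounded_linear_Im]
          field_vector_diff_chain_at[where g = ln_Gamma, unfolded o_def]
          has_field_derivative_ln_Gamma_complex derivative_eq_intros refl
          | use assms in \<open>simp add: complex_nonpos_Reals_iff u_def\<close>)+
    moreover have "Re (Digamma (of_real u + \<i> * of_real v)) > 0"
      using Re_Digamma_ge[of "of_real u + \<i> * of_real v"] Digamma_real_ge_three_halves_pos[of u] assms
      by (simp add: u_def)
    ultimately show ?thesis
      by (auto simp: has_real_derivative_iff_has_vector_derivative)
  qed
  from DERIV_pos_imp_increasing[OF assms(2) this]
  have "Im (ln_Gamma (of_real u)) < Im (ln_Gamma (of_real u + \<i> * of_real (Im z)))"
    by simp
  moreover have "of_real u + \<i> * of_real (Im z) = z"
    by (simp add: u_def complex_eq_iff)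
  moreover have "Im (ln_Gamma (complex_of_real u)) = 0"
    using assms by (simp add: u_def ln_Gamma_complex_of_real)
  ultimately show ?thesis by simp
qed

section \<open>Relation to Gamma and functional equation of its logarithm\<close>

lemma exp_ln_Gamma: "Im z > 0 \<Longrightarrow> exp (ln_Gamma z) = Gamma z"
  by (simp add: Gamma_complex_altdef not_nonpos_Int_of_Im_pos)

lemma exp_minus_ln_Gamma: "Im z > 0 \<Longrightarrow> exp (- ln_Gamma z) = rGamma z"
  by (simp add: rGamma_complex_altdef not_nonpos_Int_of_Im_pos)

lemma norm_Gamma_eq_exp: "Im z > 0 \<Longrightarrow> norm (Gamma z) = exp (Re (ln_Gamma z))"
  by (simp flip: exp_ln_Gamma)

text \<open>The functional equation of \<open>Gamma\<close> gives this only modulo 2 pi i. The exact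
  form follows because the difference of both sides has derivative 0 on the connected slit plane and
  vanishes at 1.\<close>

lemma ln_Gamma_plus1:
  assumes "Im z > 0"
  shows "ln_Gamma (z + 1) = ln_Gamma z + Ln z"
proof -
  define S where "S = - (complex_of_real ` {..0})"
  have S: "z \<in> S \<longleftrightarrow> z \<notin> \<real>\<^sub>\<le>\<^sub>0" for z
    by (force simp: S_def complex_nonpos_Reals_iff image_iff complex_eq_iff)
  have "S = - \<real>\<^sub>\<le>\<^sub>0"
    using S by auto
  then have opS: "open S"
    by (simp add: open_Compl)
  have conS: "connected S"
    unfolding S_def by (rule starlike_imp_connected[OF starlike_slotted_complex_plane_left])
  have der: "((\<lambda>z. ln_Gamma (z + 1) - ln_Gamma z - Ln z) has_field_derivative 0) (at z)" if "z \<in> S" for z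
  proof -
    have "z + 1 \<notin> \<real>\<^sub>\<le>\<^sub>0" "z \<noteq> 0" using that by (auto simp: S complex_nonpos_Reals_iff)
    then show ?thesis using that
      by (auto intro!: derivative_eq_intros simp: S Digamma_plus1 divide_inverse)
  qed
  obtain c where c: "\<And>z. z \<in> S \<Longrightarrow> ln_Gamma (z + 1) - ln_Gamma z - Ln z = c"
  proof (rule DERIV_zero_connected_constant[OF conS opS finite.emptyI])
    show "continuous_on S (\<lambda>z. ln_Gamma (z + 1) - ln_Gamma z - Ln z)"
      by (rule DERIV_continuous_on) (rule has_field_derivative_at_within[OF der])
  qed (use der in auto)
  have "(1::complex) \<in> S" "z \<in> S"
    using assms by (auto simp: S complex_nonpos_Reals_iff)
  moreover have "ln_Gamma (1 + 1 :: complex) = 0" "ln_Gamma (1 :: complex) = 0"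
    using ln_Gamma_complex_conv_fact[of 1] ln_Gamma_complex_conv_fact[of 2] by simp_all
  ultimately have "ln_Gamma (z + 1) - ln_Gamma z - Ln z = 0"
    using c[of z] c[of 1] by simp
  then show ?thesis by (simp add: algebra_simps)
qed

lemma ln_Gamma_shift:
  assumes "Im z > 0"
  shows "ln_Gamma z = ln_Gamma (z + of_nat n) - (\<Sum>i<n. Ln (z + of_nat i))"
proof (induction n)
  case (Suc n)
  have "ln_Gamma (z + of_nat n + 1) = ln_Gamma (z + of_nat n) + Ln (z + of_nat n)"
    by (rule ln_Gamma_plus1) (use assms in simp)
  then show ?case using Suc by (simp add: add_ac)
qed simp

section \<open>Critical points and boundary values\<close>

text \<open>The interval in which the paper places the zero \<open>x\<^sub>m\<close> of the derivative of \<open>Gamma\<close>.\<close>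

definition gamma_interval :: "nat \<Rightarrow> real set" where
  "gamma_interval m = {x. - real m < x \<and> (m = 0 \<or> x < - real m + 1)}"

lemma gamma_interval_convex:
  "x \<in> gamma_interval m \<Longrightarrow> y \<in> gamma_interval m \<Longrightarrow> x \<le> t \<Longrightarrow> t \<le> y \<Longrightarrow> t \<in> gamma_interval m"
  by (auto simp: gamma_interval_def)

lemma gamma_interval_not_nonpos_Int:
  assumes "x \<in> gamma_interval m"
  shows "x \<notin> \<int>\<^sub>\<le>\<^sub>0"
proof
  assume "x \<in> \<int>\<^sub>\<le>\<^sub>0"
  then obtain n where "x = - real n" by (auto elim: nonpos_Ints_cases')
  then show False using assms by (auto simp: gamma_interval_def)
qed

lemma ex_gamma_interval:
  assumes "x \<notin> \<int>\<^sub>\<le>\<^sub>0"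
  shows "\<exists>m. x \<in> gamma_interval m"
proof (cases "x > 0")
  case True
  then show ?thesis by (auto simp: gamma_interval_def intro!: exI[of _ 0])
next
  case False
  have "real_of_int \<lfloor>- x\<rfloor> \<noteq> - x"
  proof
    assume "real_of_int \<lfloor>- x\<rfloor> = - x"
    then have "x = of_int (- \<lfloor>- x\<rfloor>)" by linarith
    then show False using assms False by (metis nonpos_Ints_of_int of_int_le_0_iff linorder_not_less)
  qed
  then have "real_of_int \<lfloor>- x\<rfloor> < - x" by linarith
  moreover have "\<lfloor>- x\<rfloor> \<ge> 0" using False by simp
  ultimately have "x \<in> gamma_interval (nat (\<lfloor>- x\<rfloor> + 1))"
    by (auto simp: gamma_interval_def) linarith
  then show ?thesis ..
qed

lemma Suc_gamma_interval:
  "x \<in> gamma_interval (Suc m) \<Longrightarrow> x + 1 \<in> gamma_interval m \<and> x < 0"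
  by (auto simp: gamma_interval_def)

lemma Digamma_strict_mono_gamma_interval:
  assumes "x \<in> gamma_interval m" "y \<in> gamma_interval m" "x < y"
  shows "Digamma x < Digamma y"
proof (rule DERIV_pos_imp_increasing[OF assms(3)])
  fix t assume "x \<le> t" "t \<le> y"
  then have "t \<notin> \<int>\<^sub>\<le>\<^sub>0"
    using gamma_interval_convex[OF assms(1,2)] gamma_interval_not_nonpos_Int by blast
  then have "(Digamma has_real_derivative Polygamma 1 t) (at t)" "Polygamma 1 t > 0"
    using has_field_derivative_Polygamma[of t 0] Polygamma_real_odd_pos[of t 1] by auto
  then show "\<exists>y. (Digamma has_real_derivative y) (at t) \<and> 0 < y" by blast
qed

text \<open>By rGamma x = x * rGamma (x + 1), each unit step to the left into the next interval
  brings one negative factor.\<close>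

lemma rGamma_sign:
  "x \<in> gamma_interval m \<Longrightarrow> 0 < (-1) ^ m * (rGamma x :: real)"
proof (induction m arbitrary: x)
  case 0
  then show ?case by (simp add: gamma_interval_def rGamma_inverse_Gamma)
next
  case (Suc m)
  have "0 < (-1) ^ m * rGamma (x + 1)" and "x < 0"
    using Suc_gamma_interval[OF Suc.prems] Suc.IH by auto
  then have "0 < (-x) * ((-1) ^ m * rGamma (x + 1))" using mult_pos_pos[of "- x"] by force
  also have "\<dots> = (-1) ^ Suc m * rGamma x"
    using rGamma_plus1[of x] by (simp add: algebra_simps)
  finally show ?case .
qed

lemma rGamma_has_derivative_gamma_interval:
  "x \<in> gamma_interval m \<Longrightarrow> (rGamma has_real_derivative - rGamma x * Digamma x) (at x within A)"
  by (rule has_field_derivative_rGamma_no_nonpos_int) (rule gamma_interval_not_nonpos_Int)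

lemma deriv_Gamma_eq_0_iff:
  assumes "x \<in> gamma_interval m"
  shows "deriv Gamma x = 0 \<longleftrightarrow> Digamma x = 0"
  using DERIV_imp_deriv[OF has_field_derivative_Gamma[of x UNIV]] Gamma_nonzero[of x]
    gamma_interval_not_nonpos_Int[OF assms] by auto

text \<open>Rolle's theorem for \<open>rGamma\<close>, which is finite at the end points where
  \<open>Gamma\<close> may have poles: it vanishes at consecutive nonpositive integers, and for m =
  0 it takes the same value at 1 and 2.\<close>

lemma ex_Digamma_zero: "\<exists>x \<in> gamma_interval m. Digamma x = 0"
proof -
  define l r :: real where "l = (if m = 0 then 1 else - real m)" and "r = l + 1"
  have sub: "x \<in> gamma_interval m" if "l < x" "x < r" for x
    using that by (auto simp: gamma_interval_def l_def r_def split: if_splits)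
  have "rGamma l = rGamma r"
  proof (cases m)
    case 0
    then show ?thesis by (simp add: l_def r_def rGamma_inverse_Gamma Gamma_numeral)
  next
    case (Suc n)
    then have "l = - real (Suc n)" "r = - real n" by (auto simp: l_def r_def)
    then show ?thesis by (simp only: rGamma_neg_of_nat)
  qed
  then have "\<exists>x>l. x < r \<and> (\<lambda>h. - rGamma x * Digamma x * h) = (\<lambda>h. 0)"
  proof (intro Rolle_deriv[of l r rGamma])
    show "(rGamma has_derivative (\<lambda>h. - rGamma x * Digamma x * h)) (at x)" if "l < x" "x < r" for x
      using rGamma_has_derivative_gamma_interval[OF sub[OF that], of UNIV]
      by (simp only: has_field_derivative_def)
  qed (auto simp: r_def continuous_on_rGamma)
  then obtain x where x: "l < x" "x < r" "- rGamma x * Digamma x = 0"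
    by (metis mult.right_neutral)
  then show ?thesis
    using sub[OF x(1,2)] rGamma_sign[OF sub[OF x(1,2)]] by auto
qed

lemma gamma_crit: "gamma_crit m \<in> gamma_interval m" "Digamma (gamma_crit m) = 0"
proof -
  have "\<exists>!x. x \<in> gamma_interval m \<and> deriv Gamma x = 0"
  proof (rule ex_ex1I)
    show "\<exists>x. x \<in> gamma_interval m \<and> deriv Gamma x = 0"
      using ex_Digamma_zero[of m] deriv_Gamma_eq_0_iff by blast
    show "x = y" if "x \<in> gamma_interval m \<and> deriv Gamma x = 0" "y \<in> gamma_interval m \<and> deriv Gamma y = 0" for x y
      using that Digamma_strict_mono_gamma_interval[of x m y] Digamma_strict_mono_gamma_interval[of y m x]
      by (cases x y rule: linorder_cases) (auto simp: deriv_Gamma_eq_0_iff)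
  qed
  moreover have "gamma_crit m = (THE x. x \<in> gamma_interval m \<and> deriv Gamma x = 0)"
    by (simp add: gamma_crit_def gamma_interval_def)
  ultimately have "gamma_crit m \<in> gamma_interval m \<and> deriv Gamma (gamma_crit m) = 0"
    by (metis (mono_tags, lifting) theI')
  then show "gamma_crit m \<in> gamma_interval m" "Digamma (gamma_crit m) = 0"
    using deriv_Gamma_eq_0_iff by auto
qed

lemma Digamma_sign:
  assumes "x \<in> gamma_interval m"
  shows "x < gamma_crit m \<Longrightarrow> Digamma x < 0" "x > gamma_crit m \<Longrightarrow> Digamma x > 0"
  using Digamma_strict_mono_gamma_interval[of x m "gamma_crit m"]
    Digamma_strict_mono_gamma_interval[of "gamma_crit m" m x] gamma_crit[of m] assms by auto

text \<open>Squaring removes the sign of \<open>Gamma\<close>: the derivative 2 Gamma^2 Digamma of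
  the square changes sign exactly at the critical point. Thus the tip of a slit is the leftmost
  boundary value on its line, and it is attained at one boundary point only.\<close>

lemma abs_Gamma_gamma_crit_less:
  assumes "x \<in> gamma_interval m" "x \<noteq> gamma_crit m"
  shows "\<bar>Gamma (gamma_crit m)\<bar> < \<bar>Gamma x\<bar>"
proof -
  define c where "c = gamma_crit m"
  have c: "c \<in> gamma_interval m" using gamma_crit by (simp add: c_def)
  have der: "((\<lambda>t. (Gamma t)\<^sup>2) has_real_derivative 2 * (Gamma t)\<^sup>2 * Digamma t) (at t)"
    if "t \<in> gamma_interval m" for t
    using DERIV_power[OF has_field_derivative_Gamma[OF gamma_interval_not_nonpos_Int[OF that]], of 2]
    by (simp add: power2_eq_square mult_ac)
  have nz: "(Gamma t)\<^sup>2 > 0" if "t \<in> gamma_interval m" for t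
    using Gamma_nonzero[OF gamma_interval_not_nonpos_Int[OF that]] by simp
  have cont: "continuous_on {u..v} (\<lambda>t. (Gamma t)\<^sup>2)"
    if "u \<in> gamma_interval m" "v \<in> gamma_interval m" for u v
    by (rule DERIV_continuous_on, rule has_field_derivative_at_within, rule der)
       (rule gamma_interval_convex[OF that], auto)
  have "(Gamma c)\<^sup>2 < (Gamma x)\<^sup>2"
  proof (cases "c < x")
    case True
    show ?thesis
    proof (rule DERIV_pos_imp_increasing_open[OF True _ cont[OF c assms(1)]])
      fix t assume t: "c < t" "t < x"
      then have ti: "t \<in> gamma_interval m" using gamma_interval_convex[OF c assms(1)] by auto
      then show "\<exists>y. ((\<lambda>t. (Gamma t)\<^sup>2) has_real_derivative y) (at t) \<and> 0 < y"
        using der nz Digamma_sign(2)[OF ti] t by (force simp: c_def)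
    qed
  next
    case False
    with assms have *: "x < c" by (auto simp: c_def)
    show ?thesis
    proof (rule DERIV_neg_imp_decreasing_open[OF * _ cont[OF assms(1) c]])
      fix t assume t: "x < t" "t < c"
      then have ti: "t \<in> gamma_interval m" using gamma_interval_convex[OF assms(1) c] by auto
      then show "\<exists>y. ((\<lambda>t. (Gamma t)\<^sup>2) has_real_derivative y) (at t) \<and> y < 0"
        using der nz Digamma_sign(1)[OF ti] t by (force simp: c_def mult_pos_neg)
    qed
  qed
  then show ?thesis using abs_le_square_iff[of "Gamma x" "Gamma c"] by (simp add: c_def not_le[symmetric])
qed

lemma abs_Gamma_gamma_crit_le:
  "x \<in> gamma_interval m \<Longrightarrow> \<bar>Gamma (gamma_crit m)\<bar> \<le> \<bar>Gamma x\<bar>"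
  using abs_Gamma_gamma_crit_less by (cases "x = gamma_crit m") force+

section \<open>Monotonicity of the reciprocal Gamma function between neighbouring critical
  points\<close>

lemma gamma_crit_bounds:
  "gamma_crit (Suc k) < - real k" "- real k < gamma_crit k"
  using gamma_crit(1)[of "Suc k"] gamma_crit(1)[of k] by (auto simp: gamma_interval_def)

lemma gamma_interval_between_crit:
  assumes "gamma_crit (Suc k) \<le> p" "p \<le> gamma_crit k"
  shows "p < - real k \<Longrightarrow> p \<in> gamma_interval (Suc k)" "p > - real k \<Longrightarrow> p \<in> gamma_interval k"
  using assms gamma_crit(1)[of "Suc k"] gamma_crit(1)[of k] by (auto simp: gamma_interval_def)

text \<open>At - k the derivative is (-1)^k k!; elsewhere it is - rGamma * Digamma, whose sign
  follows from the parity of k and the position of p relative to the critical points. The complex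
  derivative is recorded with the same D for the local arguments off the axis.\<close>

lemma rGamma_deriv_pos:
  assumes "even k" "gamma_crit (Suc k) < p" "p < gamma_crit k"
  obtains D :: real where "D > 0" "(rGamma has_real_derivative D) (at p)"
    "(rGamma has_field_derivative complex_of_real D) (at (complex_of_real p))"
proof -
  consider (less) "p < - real k" | (eq) "p = - real k" | (greater) "p > - real k" by linarith
  then obtain D :: real where D: "D > 0" "(rGamma has_real_derivative D) (at p)"
  proof cases
    case less
    then have p: "p \<in> gamma_interval (Suc k)" using gamma_interval_between_crit assms by auto
    show ?thesis
      using that[of "- rGamma p * Digamma p"] rGamma_has_derivative_gamma_interval[OF p]
        rGamma_sign[OF p] Digamma_sign[OF p] assms by (simp add: mult_neg_pos)
  next
    case eq
    show ?thesis
      using that[of "fact k"] has_field_derivative_rGamma_nonpos_int[of k UNIV] assms eq by simp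
  next
    case greater
    then have p: "p \<in> gamma_interval k" using gamma_interval_between_crit assms by auto
    show ?thesis
      using that[of "- rGamma p * Digamma p"] rGamma_has_derivative_gamma_interval[OF p]
        rGamma_sign[OF p] Digamma_sign[OF p] assms by (simp add: mult_pos_neg)
  qed
  \<comment> \<open>Along the real axis both E and D are vector derivatives of the same function, so
    they coincide.\<close>
  obtain E where E: "(rGamma has_field_derivative E) (at (complex_of_real p))"
    using has_field_derivative_rGamma by blast
  have "((\<lambda>t. rGamma (complex_of_real t)) has_vector_derivative 1 * E) (at p)"
    by (intro field_vector_diff_chain_at[where g = rGamma, unfolded o_def] E)
       (auto intro!: derivative_eq_intros)
  moreover have "((\<lambda>t. complex_of_real (rGamma t)) has_vector_derivative of_real D) (at p)"
    using D(2) by (intro has_vector_derivative_of_real) (simp add: has_real_derivative_iff_has_vector_derivative)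
  ultimately have "E = of_real D"
    by (simp add: rGamma_complex_of_real vector_derivative_unique_at)
  then show ?thesis using that D E by simp
qed

lemma rGamma_strict_mono_between_crit:
  assumes "even k" "gamma_crit (Suc k) \<le> x" "x < y" "y \<le> gamma_crit k"
  shows "rGamma x < (rGamma y :: real)"
proof (rule DERIV_pos_imp_increasing_open[OF assms(3)])
  fix t assume "x < t" "t < y"
  then show "\<exists>y. (rGamma has_real_derivative y) (at t) \<and> 0 < y"
    using rGamma_deriv_pos[of k t] assms by (metis less_le_trans order_less_trans order_le_less_trans)
qed (rule continuous_on_rGamma)

lemma rGamma_gamma_crit_signs:
  assumes "even k"
  shows "rGamma (gamma_crit (Suc k)) < (0::real)" "rGamma (gamma_crit k) > (0::real)"
  using rGamma_sign[OF gamma_crit(1), of k] rGamma_sign[OF gamma_crit(1), of "Suc k"] assms by auto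

text \<open>Passing to reciprocals joins the two pieces into one interval on which
  \<open>rGamma\<close> increases from a negative to a positive value; the removed zero at - k
  separates the two rays of the range.\<close>

lemma bij_betw_Gamma:
  assumes "even k"
  shows "bij_betw Gamma ({gamma_crit (Suc k)<..<- real k} \<union> {- real k<..<gamma_crit k})
    ({..<Gamma (gamma_crit (Suc k))} \<union> {Gamma (gamma_crit k)<..})"
    (is "bij_betw _ ?I ?J")
proof -
  let ?p = "gamma_crit (Suc k)" and ?q = "gamma_crit k"
  let ?A = "rGamma ?p :: real" and ?B = "rGamma ?q :: real"
  note mono = rGamma_strict_mono_between_crit[OF assms]
  note bd = gamma_crit_bounds[of k]
  have AB: "?A < 0" "?B > 0" using rGamma_gamma_crit_signs[OF assms] by auto
  have G: "Gamma x = inverse (rGamma x)" for x :: real by (simp add: rGamma_inverse_Gamma)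
  have "inj_on Gamma ?I"
  proof (rule inj_onI)
    fix x y assume "x \<in> ?I" "y \<in> ?I" "Gamma x = Gamma y"
    then show "x = y"
      using mono[of x y] mono[of y x] bd by (cases x y rule: linorder_cases) (auto simp: G)
  qed
  moreover have "Gamma ` ?I = ?J"
  proof (intro equalityI subsetI)
    fix t assume "t \<in> Gamma ` ?I"
    then obtain x where x: "x \<in> ?I" "t = inverse (rGamma x)" unfolding G by blast
    consider "?p < x" "x < - real k" | "- real k < x" "x < ?q" using x by auto
    then show "t \<in> ?J"
    proof cases
      case 1
      then have "?A < rGamma x" "rGamma x < 0"
        using mono[of ?p x] mono[of x "- real k"] bd by auto
      then show ?thesis using AB x by (auto simp: G inverse_less_iff_less_neg)
    next
      case 2
      then have "rGamma x < ?B" "rGamma x > 0"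
        using mono[of x ?q] mono[of "- real k" x] bd by auto
      then show ?thesis using AB x by (auto simp: G inverse_less_iff_less)
    qed
  next
    fix t assume t: "t \<in> ?J"
    consider "t < inverse ?A" | "inverse ?B < t" using t by (auto simp: G)
    then have t0: "t \<noteq> 0" and tAB: "?A < inverse t" "inverse t < ?B"
    proof (atomize (full), cases)
      case 1
      moreover have "inverse ?A < 0" using AB by simp
      ultimately have "t < 0" "inverse (inverse ?A) < inverse t"
        using inverse_less_iff_less_neg[of "inverse ?A" t] by linarith+
      moreover have "inverse t < ?B"
        using \<open>t < 0\<close> AB(2) negative_imp_inverse_negative order_less_trans by blast
      ultimately show "t \<noteq> 0 \<and> ?A < inverse t \<and> inverse t < ?B" by simp
    next
      case 2
      moreover have "inverse ?B > 0" using AB by simp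
      ultimately have t: "t > 0" by linarith
      have "inverse t < inverse (inverse ?B)"
        using \<open>inverse ?B < t\<close> \<open>inverse ?B > 0\<close> by (rule less_imp_inverse_less)
      moreover have "?A < inverse t"
        using \<open>t > 0\<close> AB(1) positive_imp_inverse_positive order_less_trans by blast
      ultimately show "t \<noteq> 0 \<and> ?A < inverse t \<and> inverse t < ?B" using t by simp
    qed
    obtain x where x: "?p \<le> x" "x \<le> ?q" "rGamma x = inverse t"
      using IVT'[of rGamma ?p "inverse t" ?q] tAB bd continuous_on_rGamma by fastforce
    then have "x \<noteq> ?p" "x \<noteq> ?q" "x \<noteq> - real k"
      using tAB t0 by auto
    then show "t \<in> Gamma ` ?I"
      using x by (intro image_eqI[of _ _ x]) (auto simp: G)
  qed
  ultimately show ?thesis by (simp add: bij_betw_def)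
qed

text \<open>The numbers z + i with i < m approach the cut of the logarithm from above, where Ln w =
  Ln (- w) + \<i> pi and the right-hand side is continuous. The counters are separate for two uses:
  n = m treats regular boundary points, while n = m + 1 treats the pole - m, where Ln (z + m) has no
  limit and stays outside the sum.\<close>

lemma tendsto_Im_shifted_ln_Gamma:
  assumes "p + real n > 0" "\<And>i. i < m \<Longrightarrow> p + real i < 0"
  shows "((\<lambda>z. Im (ln_Gamma (z + of_nat n) - (\<Sum>i<m. Ln (z + of_nat i)))) \<longlongrightarrow> - (real m * pi))
    (at (complex_of_real p) within upper_half_plane)"
proof -
  let ?F = "at (complex_of_real p) within upper_half_plane"
  have "((\<lambda>z. Im (ln_Gamma (z + of_nat n) - (\<Sum>i<m. Ln (- (z + of_nat i)) + \<i> * pi))) \<longlongrightarrow>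
      Im (ln_Gamma (of_real p + of_nat n) - (\<Sum>i<m. Ln (- (of_real p + of_nat i)) + \<i> * pi))) ?F"
  proof (intro tendsto_Im tendsto_diff tendsto_sum tendsto_add tendsto_const)
    show "((\<lambda>z. ln_Gamma (z + of_nat n)) \<longlongrightarrow> ln_Gamma (of_real p + of_nat n)) ?F"
    proof (rule isCont_tendsto_compose[of _ ln_Gamma])
      show "isCont ln_Gamma (complex_of_real p + of_nat n)"
        by (intro isCont_ln_Gamma_complex continuous_ident)
           (use assms(1) in \<open>auto simp: complex_nonpos_Reals_iff\<close>)
    qed (intro tendsto_intros)
    show "((\<lambda>z. Ln (- (z + of_nat i))) \<longlongrightarrow> Ln (- (of_real p + of_nat i))) ?F" if "i \<in> {..<m}" for i
      by (intro tendsto_intros) (use assms(2)[of i] that in \<open>auto simp: complex_nonpos_Reals_iff\<close>)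
  qed
  also have "Im (ln_Gamma (of_real p + of_nat n) - (\<Sum>i<m. Ln (- (of_real p + of_nat i)) + \<i> * pi)) = - (real m * pi)"
  proof -
    have "Im (ln_Gamma (of_real p + of_nat n)) = 0"
      using ln_Gamma_complex_of_real[of "p + real n"] assms by simp
    moreover have "Im (Ln (- (of_real p + of_nat i))) = 0" if "i < m" for i
      using Ln_of_real[of "- (p + real i)"] assms(2)[OF that] by simp
    ultimately show ?thesis by simp
  qed
  finally show ?thesis
  proof (rule Lim_transform_eventually)
    have "Ln w = Ln (- w) + \<i> * pi" if "Im w > 0" for w
    proof -
      have "w \<noteq> 0" using that by auto
      then show ?thesis using that Ln_minus[of w] by (simp split: if_splits)
    qed
    then have "Im (ln_Gamma (z + of_nat n) - (\<Sum>i<m. Ln (- (z + of_nat i)) + \<i> * pi)) =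
        Im (ln_Gamma (z + of_nat n) - (\<Sum>i<m. Ln (z + of_nat i)))" if "Im z > 0" for z
      using that by (auto intro!: arg_cong[of _ _ Im] sum.cong)
    then show "\<forall>\<^sub>F z in ?F. Im (ln_Gamma (z + of_nat n) - (\<Sum>i<m. Ln (- (z + of_nat i)) + \<i> * pi)) =
        Im (ln_Gamma (z + of_nat n) - (\<Sum>i<m. Ln (z + of_nat i)))"
      by (auto simp: eventually_at_filter upper_half_plane_def)
  qed
qed

text \<open>The boundary value approached from the upper half plane at a point x of
  \<open>gamma_interval m\<close>; for x = \<open>gamma_crit m\<close> it is the tip of slit number
  m.\<close>

definition ln_Gamma_bdry :: "nat \<Rightarrow> real \<Rightarrow> complex" where
  "ln_Gamma_bdry m x = Complex (ln \<bar>Gamma x\<bar>) (- (real m * pi))"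

lemma tendsto_ln_Gamma_bdry:
  assumes "x \<in> gamma_interval m"
  shows "(ln_Gamma \<longlongrightarrow> ln_Gamma_bdry m x) (at (complex_of_real x) within upper_half_plane)"
proof -
  let ?F = "at (complex_of_real x) within upper_half_plane"
  have ev: "\<forall>\<^sub>F z in ?F. Im z > 0"
    by (auto simp: eventually_at_filter upper_half_plane_def)
  have "((\<lambda>z. Im (ln_Gamma (z + of_nat m) - (\<Sum>i<m. Ln (z + of_nat i)))) \<longlongrightarrow> - (real m * pi)) ?F"
    by (rule tendsto_Im_shifted_ln_Gamma) (use assms in \<open>auto simp: gamma_interval_def\<close>)
  then have "((\<lambda>z. Im (ln_Gamma z)) \<longlongrightarrow> - (real m * pi)) ?F"
    by (rule Lim_transform_eventually) (use ev in eventually_elim, metis ln_Gamma_shift)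
  moreover have "((\<lambda>z. ln (norm (Gamma z))) \<longlongrightarrow> ln (norm (Gamma (complex_of_real x)))) ?F"
    using gamma_interval_not_nonpos_Int[OF assms] Gamma_nonzero[of x]
    by (intro tendsto_intros) (auto simp: Gamma_complex_of_real of_real_in_nonpos_Ints_iff)
  then have "((\<lambda>z. Re (ln_Gamma z)) \<longlongrightarrow> ln \<bar>Gamma x\<bar>) ?F"
    unfolding Gamma_complex_of_real norm_of_real
    by (rule Lim_transform_eventually) (use ev in eventually_elim, simp add: norm_Gamma_eq_exp)
  ultimately have "((\<lambda>z. Complex (Re (ln_Gamma z)) (Im (ln_Gamma z))) \<longlongrightarrow> ln_Gamma_bdry m x) ?F"
    unfolding ln_Gamma_bdry_def by (intro tendsto_Complex)
  then show ?thesis by simp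
qed

text \<open>Near the pole the imaginary part of Ln (z + m) can be anything between 0 and pi, so only
  an interval, widened by \<delta>, can be asserted.\<close>

lemma eventually_Im_ln_Gamma_near_pole:
  assumes "\<delta> > 0"
  shows "\<forall>\<^sub>F z in at (- of_nat m) within upper_half_plane.
    Im (ln_Gamma z) \<in> {- (real (Suc m) * pi) - \<delta> <..< - (real m * pi) + \<delta>}"
proof -
  let ?F = "at (complex_of_real (- real m)) within upper_half_plane"
  have ev: "\<forall>\<^sub>F z in ?F. Im z > 0"
    by (auto simp: eventually_at_filter upper_half_plane_def)
  have "((\<lambda>z. Im (ln_Gamma (z + of_nat (Suc m)) - (\<Sum>i<m. Ln (z + of_nat i)))) \<longlongrightarrow> - (real m * pi)) ?F"
    by (rule tendsto_Im_shifted_ln_Gamma) auto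
  from tendstoD[OF this assms] ev have "\<forall>\<^sub>F z in ?F.
    Im (ln_Gamma z) \<in> {- (real (Suc m) * pi) - \<delta> <..< - (real m * pi) + \<delta>}"
  proof eventually_elim
    case (elim z)
    have "Im (Ln (z + of_nat m)) \<in> {0<..<pi}"
      using elim(2) Im_Ln_pos_lt_imp[of "z + of_nat m"] by (simp add: greaterThanLessThan_iff)
    moreover have "Im (ln_Gamma z) = Im (ln_Gamma (z + of_nat (Suc m)) - (\<Sum>i<m. Ln (z + of_nat i)))
        - Im (Ln (z + of_nat m))"
      using ln_Gamma_shift[OF elim(2), of "Suc m"] by simp
    ultimately show ?case using elim(1) by (auto simp: dist_real_def algebra_simps abs_if split: if_splits)
  qed
  then show ?thesis by simp
qed

section \<open>Growth, properness and the image of ln_Gamma\<close>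

text \<open>In the product formula \<open>Gamma_series\<close> the modulus of the numerator depends
  on Re z alone, and each denominator factor satisfies |z + j| \<ge> Re z + j.\<close>

lemma norm_Gamma_le:
  assumes "Re z > 0"
  shows "norm (Gamma z) \<le> Gamma (Re z)"
proof (rule LIMSEQ_le)
  show "(\<lambda>n. norm (Gamma_series z n)) \<longlonglongrightarrow> norm (Gamma z)"
    by (intro tendsto_norm Gamma_series_LIMSEQ)
  show "Gamma_series (Re z) \<longlonglongrightarrow> Gamma (Re z)"
    by (rule Gamma_series_LIMSEQ)
  have "norm (Gamma_series z n) \<le> Gamma_series (Re z) n" for n
  proof -
    have "0 < pochhammer (Re z) (n + 1)"
      using assms by (rule pochhammer_pos)
    moreover have "pochhammer (Re z) (n + 1) \<le> norm (pochhammer z (n + 1))"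
      unfolding pochhammer_prod prod_norm[symmetric]
      by (intro prod_mono) (use assms complex_Re_le_cmod[of "z + of_nat _"] in auto)
    ultimately show ?thesis
      unfolding Gamma_series_def by (simp add: norm_mult norm_divide frac_le)
  qed
  then show "\<exists>N. \<forall>n\<ge>N. norm (Gamma_series z n) \<le> Gamma_series (Re z) n" by blast
qed

text \<open>The functional equation moves w to the right until \<open>norm_Gamma_le\<close> applies.
  Of the factors passed on the way, the first two contribute |w| (|w| - 1), and all others have
  modulus at least 1 because Im w \<ge> 1.\<close>

lemma Gamma_decay:
  assumes "Im w \<ge> 1" "Re w \<le> 2"
  shows "norm (Gamma w) * (norm w * (norm w - 1)) \<le> Gamma 5"
proof -
  \<comment> \<open>The shift by n + 2 brings the real part into [4, 5), where \<open>Gamma\<close>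
    is increasing and hence at most Gamma 5. Since Re w \<le> 2, the rounded-up difference is at
    least 2, so the truncation by \<open>nat\<close> is harmless.\<close>
  define n where "n = nat (\<lceil>4 - Re w\<rceil> - 2)"
  have n: "4 \<le> Re w + real (n + 2)" "Re w + real (n + 2) < 5"
    unfolding n_def using assms(2) by linarith+
  have w: "w \<notin> \<int>\<^sub>\<le>\<^sub>0" using assms not_nonpos_Int_of_Im_pos[of w] by simp
  have wb: "norm w \<ge> 1" using assms abs_Im_le_cmod[of w] by linarith
  have "norm (w + 1) \<ge> norm w - 1"
    using norm_triangle_ineq4[of "w + 1" 1] by simp
  moreover have "norm (pochhammer (w + 2) n) \<ge> 1"
    unfolding pochhammer_prod prod_norm[symmetric]
  proof (rule prod_ge_1)
    fix i show "1 \<le> norm (w + 2 + of_nat i)"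
      using assms abs_Im_le_cmod[of "w + 2 + of_nat i"] by simp
  qed
  ultimately have "(norm w * (norm w - 1)) * 1 \<le> (norm w * norm (w + 1)) * norm (pochhammer (w + 2) n)"
    using wb by (intro mult_mono) auto
  also have "\<dots> = norm (pochhammer w (n + 2))"
    by (simp add: pochhammer_rec norm_mult add_ac mult_ac)
  finally have "norm (Gamma w) * (norm w * (norm w - 1)) \<le> norm (pochhammer w (n + 2)) * norm (Gamma w)"
    by (simp add: mult.commute mult_left_mono)
  also have "\<dots> = norm (Gamma (w + of_nat (n + 2)))"
    using pochhammer_Gamma[OF w, of "n + 2"] Gamma_nonzero[OF w]
    by (metis nonzero_divide_eq_eq norm_mult)
  also have "\<dots> \<le> Gamma (Re w + real (n + 2))"
    using norm_Gamma_le[of "w + of_nat (n + 2)"] n by simp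
  also have "\<dots> \<le> Gamma 5"
    using Gamma_real_strict_mono[of "Re w + real (n + 2)" 5] n by simp
  finally show ?thesis .
qed

text \<open>Each shift with Re (w + i) < 0 subtracts an argument of at least pi / 2, while the
  shifted value stays below the maximum C on the segment Re = 1. A point too far to the left would
  therefore have imaginary part below - K.\<close>

lemma Re_bounded_below_of_Im_ln_Gamma:
  obtains L where "\<And>w. 0 < Im w \<Longrightarrow> Im w \<le> 1 \<Longrightarrow> - K \<le> Im (ln_Gamma w) \<Longrightarrow> - L \<le> Re w"
proof -
  have "continuous_on {0..1} (\<lambda>v. Im (ln_Gamma (Complex 1 v)))"
    unfolding Complex_eq
    by (intro continuous_on_Im continuous_on_compose2[OF continuous_on_ln_Gamma_complex[of "- \<real>\<^sub>\<le>\<^sub>0"]]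
        continuous_intros) (auto simp: complex_nonpos_Reals_iff)
  then have "bounded ((\<lambda>v. Im (ln_Gamma (Complex 1 v))) ` {0..1})"
    by (intro compact_imp_bounded compact_continuous_image) auto
  then obtain C where C: "\<And>v. 0 \<le> v \<Longrightarrow> v \<le> 1 \<Longrightarrow> \<bar>Im (ln_Gamma (Complex 1 v))\<bar> \<le> C"
    unfolding bounded_iff by (metis atLeastAtMost_iff image_eqI real_norm_def)
  obtain n :: nat where n: "(C + K) / (pi / 2) < real n"
    using reals_Archimedean2 by blast
  show ?thesis
  proof (rule that[of "real n"], rule ccontr)
    fix w assume w: "0 < Im w" "Im w \<le> 1" "- K \<le> Im (ln_Gamma w)" "\<not> - real n \<le> Re w"
    have "pi / 2 \<le> Im (Ln (w + of_nat i))" if "i < n" for i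
    proof -
      have "Re (w + of_nat i) < 0" "Im (w + of_nat i) > 0" using that w by auto
      then have "\<not> \<bar>Im (Ln (w + of_nat i))\<bar> < pi / 2" "Im (Ln (w + of_nat i)) > 0"
        using Re_Ln_pos_lt[of "w + of_nat i"] Im_Ln_pos_lt_imp[of "w + of_nat i"]
        by (metis less_asym zero_complex.simps(1) less_irrefl)+
      then show ?thesis by linarith
    qed
    then have "real n * (pi / 2) \<le> (\<Sum>i<n. Im (Ln (w + of_nat i)))"
      using sum_bounded_below[of "{..<n}" "pi / 2" "\<lambda>i. Im (Ln (w + of_nat i))"] by simp
    moreover have "Im (ln_Gamma (w + of_nat n)) \<le> C"
    proof -
      have "Im (ln_Gamma (Complex (Re w + real n) (Im w))) \<le> Im (ln_Gamma (Complex 1 (Im w)))"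
        by (rule Im_ln_Gamma_mono) (use w in auto)
      moreover have "Complex (Re w + real n) (Im w) = w + of_nat n" by (simp add: complex_eq_iff)
      ultimately show ?thesis using C[of "Im w"] w by simp
    qed
    moreover have "Im (ln_Gamma w) = Im (ln_Gamma (w + of_nat n)) - (\<Sum>i<n. Im (Ln (w + of_nat i)))"
      by (subst ln_Gamma_shift[OF w(1), of n]) simp
    moreover have "C + K < real n * (pi / 2)"
      using n by (simp add: field_simps)
    ultimately show False using w(3) by linarith
  qed
qed

text \<open>Up to height 1 the real part is bounded on both sides, on the right by
  \<open>Im_ln_Gamma_pos\<close>. Above height 1 the quadratic decay of \<open>Gamma\<close> bounds
  |w|^2 by a multiple of 1 / |Gamma w|, which is where the square root and the constant 2 * Gamma 5
  come from.\<close>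

lemma norm_le_of_Im_ln_Gamma_bounded:
  obtains A B where "A \<ge> 0" "B \<ge> 0" "\<And>w. 0 < Im w \<Longrightarrow> Im (ln_Gamma w) \<in> {- K..0} \<Longrightarrow>
    norm w \<le> A + B / sqrt (norm (Gamma w))"
proof -
  obtain L where L: "\<And>w. 0 < Im w \<Longrightarrow> Im w \<le> 1 \<Longrightarrow> - K \<le> Im (ln_Gamma w) \<Longrightarrow> - L \<le> Re w"
    using Re_bounded_below_of_Im_ln_Gamma by blast
  define A B :: real where "A = \<bar>L\<bar> + 3" and "B = sqrt (2 * Gamma 5)"
  have AB: "A \<ge> 0" "B \<ge> 0" by (auto simp: A_def B_def)
  show ?thesis
  proof (rule that[OF AB])
    fix w assume w: "0 < Im w" "Im (ln_Gamma w) \<in> {- K..0}"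
    have Re: "Re w < 3 / 2"
      using Im_ln_Gamma_pos[of w] w by force
    have G: "norm (Gamma w) > 0"
      using w not_nonpos_Int_of_Im_pos by (simp add: Gamma_eq_zero_iff)
    then have pos: "B / sqrt (norm (Gamma w)) \<ge> 0" using AB by simp
    consider "Im w \<le> 1" | "norm w \<le> 2" | "Im w \<ge> 1" "norm w \<ge> 2" by linarith
    then show "norm w \<le> A + B / sqrt (norm (Gamma w))"
    proof cases
      case 1
      then have "\<bar>Re w\<bar> \<le> \<bar>L\<bar> + 2" using L[of w] w Re by auto
      then have "norm w \<le> A" using cmod_le[of w] 1 w by (simp add: A_def)
      then show ?thesis using pos by simp
    next
      case 2
      then show ?thesis using pos by (simp add: A_def)
    next
      case 3
      have "norm (Gamma w) * (norm w * (norm w / 2)) \<le> norm (Gamma w) * (norm w * (norm w - 1))"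
        using 3 by (intro mult_left_mono) auto
      also have "\<dots> \<le> Gamma 5"
        using Gamma_decay 3 Re by simp
      finally have "(norm w)\<^sup>2 \<le> 2 * Gamma 5 / norm (Gamma w)"
        using G by (simp add: field_simps power2_eq_square)
      then have "norm w \<le> sqrt (2 * Gamma 5 / norm (Gamma w))"
        by (rule real_le_rsqrt)
      then show ?thesis using AB by (simp add: B_def real_sqrt_divide)
    qed
  qed
qed

text \<open>This is the properness of \<open>ln_Gamma\<close> over closed horizontal strips.\<close>

lemma ln_Gamma_limit_cases:
  assumes z: "\<And>n. 0 < Im (z n)" "\<And>n. Im (ln_Gamma (z n)) \<in> {- K..0}"
    and lim: "(\<lambda>n. ln_Gamma (z n)) \<longlonglongrightarrow> w"
  obtains r :: "nat \<Rightarrow> nat" and l where "strict_mono r" "(z \<circ> r) \<longlonglongrightarrow> l"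
    "(0 < Im l \<and> ln_Gamma l = w) \<or> (\<exists>m x. x \<in> gamma_interval m \<and> l = of_real x \<and> w = ln_Gamma_bdry m x)"
proof -
  obtain A B where AB: "A \<ge> 0" "B \<ge> 0" "\<And>w. 0 < Im w \<Longrightarrow> Im (ln_Gamma w) \<in> {- K..0} \<Longrightarrow>
    norm w \<le> A + B / sqrt (norm (Gamma w))"
    using norm_le_of_Im_ln_Gamma_bounded by blast
  have "(\<lambda>n. A + B / sqrt (norm (exp (ln_Gamma (z n))))) \<longlonglongrightarrow> A + B / sqrt (norm (exp w))"
    by (intro tendsto_intros lim) auto
  then have "Bseq (\<lambda>n. A + B / sqrt (norm (exp (ln_Gamma (z n)))))"
    by (rule Bseq_conv_Bfun[THEN iffD1, OF convergent_imp_Bseq[OF convergentI]])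
  then obtain M where M: "\<And>n. \<bar>A + B / sqrt (norm (exp (ln_Gamma (z n))))\<bar> \<le> M"
    by (auto simp: Bseq_def)
  have "norm (z n) \<le> M" for n
    using AB(3)[OF z(1,2), of n] M[of n] exp_ln_Gamma[OF z(1), of n] by simp
  then have "bounded (range z)"
    by (auto simp: bounded_iff)
  then obtain l r where r: "strict_mono r" and l: "(z \<circ> r) \<longlonglongrightarrow> l"
    using bounded_imp_convergent_subsequence by blast
  have lim': "(\<lambda>n. ln_Gamma (z (r n))) \<longlonglongrightarrow> w"
    using LIMSEQ_subseq_LIMSEQ[OF lim r] by (simp add: o_def)
  have l': "(\<lambda>n. z (r n)) \<longlonglongrightarrow> l" using l by (simp add: o_def)
  have "Im l \<ge> 0"
    by (rule tendsto_lowerbound[OF tendsto_Im[OF l']]) (auto simp: less_imp_le z)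
  then consider "Im l > 0" | "l = of_real (Re l)"
    by (cases "Im l = 0") (auto simp: complex_eq_iff)
  then have "(0 < Im l \<and> ln_Gamma l = w) \<or> (\<exists>m x. x \<in> gamma_interval m \<and> l = of_real x \<and> w = ln_Gamma_bdry m x)"
  proof cases
    case 1
    then have "isCont ln_Gamma l"
      using has_field_derivative_ln_Gamma_Im_pos[of l UNIV] by (blast intro: DERIV_isCont)
    then have "(\<lambda>n. ln_Gamma (z (r n))) \<longlonglongrightarrow> ln_Gamma l"
      using l' by (rule isCont_tendsto_compose)
    then show ?thesis using 1 LIMSEQ_unique lim' by blast
  next
    case 2
    define x where "x = Re l"
    have lx: "l = of_real x" using 2 by (simp add: x_def)
    \<comment> \<open>Since \<open>rGamma\<close> is entire, it has a limit even if l were a pole of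
      \<open>Gamma\<close>; that limit equals exp (- w), which is nonzero, so poles are
      excluded.\<close>
    have "(\<lambda>n. rGamma (z (r n))) \<longlonglongrightarrow> rGamma l"
      using l' by (intro isCont_tendsto_compose[of _ rGamma] isCont_rGamma) auto
    moreover have "(\<lambda>n. rGamma (z (r n))) \<longlonglongrightarrow> exp (- w)"
      using tendsto_exp[OF tendsto_minus[OF lim']] by (simp add: exp_minus_ln_Gamma z)
    ultimately have "rGamma l = exp (- w)" by (rule LIMSEQ_unique)
    then have "x \<notin> \<int>\<^sub>\<le>\<^sub>0" by (auto simp: lx rGamma_complex_of_real rGamma_eq_zero_iff[symmetric])
    then obtain m where m: "x \<in> gamma_interval m" using ex_gamma_interval by blast
    have "filterlim (\<lambda>n. z (r n)) (at (of_real x) within upper_half_plane) sequentially"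
      unfolding filterlim_at
    proof
      have "z (r n) \<in> upper_half_plane \<and> z (r n) \<noteq> of_real x" for n
        using z(1)[of "r n"] unfolding upper_half_plane_def
        by (metis Im_complex_of_real less_irrefl mem_Collect_eq)
      then show "\<forall>\<^sub>F n in sequentially. z (r n) \<in> upper_half_plane \<and> z (r n) \<noteq> of_real x"
        by (intro always_eventually allI)
    qed (use l' lx in metis)
    then have "(\<lambda>n. ln_Gamma (z (r n))) \<longlonglongrightarrow> ln_Gamma_bdry m x"
      by (rule filterlim_compose[OF tendsto_ln_Gamma_bdry[OF m]])
    then show ?thesis using LIMSEQ_unique lim' m lx by blast
  qed
  then show ?thesis using that r l by blast
qed

text \<open>\<open>rGamma\<close> is real on the axis, and near p its derivative has positive real
  part, so its imaginary part increases from 0 along vertical segments, which stay inside the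
  ball.\<close>

lemma Im_rGamma_sign_near_real:
  assumes "D > 0" "(rGamma has_field_derivative complex_of_real D) (at (complex_of_real p))"
  obtains r where "r > 0" "\<And>z. z \<in> ball (of_real p) r \<Longrightarrow> Im z > 0 \<Longrightarrow> Im (rGamma z) > 0"
proof -
  have "continuous_on UNIV (\<lambda>z. Re (deriv rGamma z :: complex))"
    by (rule continuous_on_Re[OF holomorphic_on_imp_continuous_on[OF holomorphic_deriv[OF holomorphic_rGamma open_UNIV]]])
  then have "open {z::complex. 0 < Re (deriv rGamma z)}"
    by (rule open_Collect_less[OF continuous_on_const])
  moreover have "of_real p \<in> {z::complex. 0 < Re (deriv rGamma z)}"
    using DERIV_imp_deriv[OF assms(2)] assms(1) by simp
  ultimately obtain r where r: "r > 0" "ball (of_real p) r \<subseteq> {z::complex. 0 < Re (deriv rGamma z)}"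
    using openE by blast
  show ?thesis
  proof (rule that[OF r(1)])
    fix z :: complex assume z: "z \<in> ball (of_real p) r" "Im z > 0"
    have "Im (rGamma (of_real (Re z) + \<i> * of_real 0)) < Im (rGamma (of_real (Re z) + \<i> * of_real (Im z)))"
    proof (rule DERIV_pos_imp_increasing[OF z(2)])
      fix v assume v: "0 \<le> v" "v \<le> Im z"
      let ?w = "of_real (Re z) + \<i> * of_real v"
      have "dist (complex_of_real p) ?w \<le> dist (complex_of_real p) z"
        unfolding dist_norm cmod_def using v by (simp add: power_mono)
      then have "?w \<in> ball (of_real p) r" using z by simp
      then have "Re (deriv rGamma ?w) > 0" using r by blast
      moreover have "(rGamma has_field_derivative deriv rGamma ?w) (at ?w)"
        using field_differentiable_rGamma DERIV_deriv_iff_field_differentiable by blast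
      then have "((\<lambda>v. Im (rGamma (of_real (Re z) + \<i> * of_real v))) has_vector_derivative
          Im (\<i> * deriv rGamma ?w)) (at v)"
        by (intro bounded_linear.has_vector_derivative[OF bounded_linear_Im]
            field_vector_diff_chain_at[where g = rGamma, unfolded o_def])
           (auto intro!: derivative_eq_intros)
      ultimately show "\<exists>y. ((\<lambda>v. Im (rGamma (of_real (Re z) + \<i> * of_real v))) has_real_derivative y) (at v) \<and> 0 < y"
        by (auto simp: has_real_derivative_iff_has_vector_derivative)
    qed
    then show "Im (rGamma z) > 0"
      by (simp add: rGamma_complex_of_real flip: complex_eq)
  qed
qed

section \<open>The strip between two neighbouring slits\<close>

definition gamma_strip :: "nat \<Rightarrow> complex set" where
  "gamma_strip k = {w. Im w \<in> {- (real (Suc k) * pi)<..<- (real k * pi)}}"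

text \<open>The boundary behaviour only places Im (ln_Gamma z) within pi / 2 of the closed strip.
  The sign of Im (rGamma z) decides the rest: for even k it is the sign of sin t, where t is the
  depth below the upper line, and - pi / 2 < t < 3 pi / 2 leaves only 0 < t < pi.\<close>

lemma eventually_ln_Gamma_in_strip:
  assumes k: "even k" and p: "gamma_crit (Suc k) < p" "p < gamma_crit k"
  shows "\<forall>\<^sub>F z in at (complex_of_real p) within upper_half_plane. ln_Gamma z \<in> gamma_strip k"
proof -
  let ?F = "at (complex_of_real p) within upper_half_plane"
  obtain D where D: "D > 0" "(rGamma has_field_derivative complex_of_real D) (at (complex_of_real p))"
    using rGamma_deriv_pos[OF k p] by metis
  obtain r where r: "r > 0" "\<And>z. z \<in> ball (of_real p) r \<Longrightarrow> Im z > 0 \<Longrightarrow> Im (rGamma z) > 0"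
    using Im_rGamma_sign_near_real[OF D] by blast
  have ev: "\<forall>\<^sub>F z in ?F. Im z > 0"
    by (auto simp: eventually_at_filter upper_half_plane_def)
  have ev': "\<forall>\<^sub>F z in ?F. z \<in> ball (of_real p) r"
    using eventually_at_ball[OF r(1)] by (rule eventually_mono) simp
  have "\<forall>\<^sub>F z in ?F. Im (ln_Gamma z) \<in> {- (real (Suc k) * pi) - pi / 2 <..< - (real k * pi) + pi / 2}"
  proof -
    consider "p < - real k" | "p = - real k" | "p > - real k" by linarith
    then show ?thesis
    proof cases
      case 1
      then have "p \<in> gamma_interval (Suc k)" using gamma_interval_between_crit p by auto
      from tendsto_Im[OF tendsto_ln_Gamma_bdry[OF this]]
      have "((\<lambda>z. Im (ln_Gamma z)) \<longlongrightarrow> - (real (Suc k) * pi)) ?F"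
        by (simp add: ln_Gamma_bdry_def)
      from tendstoD[OF this, of "pi / 2"] show ?thesis
        by (rule eventually_mono) (auto simp: dist_real_def abs_if algebra_simps split: if_splits)
    next
      case 2
      then show ?thesis
        using eventually_Im_ln_Gamma_near_pole[of "pi / 2" k] by simp
    next
      case 3
      then have "p \<in> gamma_interval k" using gamma_interval_between_crit p by auto
      from tendsto_Im[OF tendsto_ln_Gamma_bdry[OF this]]
      have "((\<lambda>z. Im (ln_Gamma z)) \<longlongrightarrow> - (real k * pi)) ?F"
        by (simp add: ln_Gamma_bdry_def)
      from tendstoD[OF this, of "pi / 2"] show ?thesis
        by (rule eventually_mono) (auto simp: dist_real_def abs_if algebra_simps split: if_splits)
    qed
  qed
  then show ?thesis using ev ev'
  proof eventually_elim
    case (elim z)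
    define t where "t = - Im (ln_Gamma z) - real k * pi"
    have t: "- (pi / 2) < t" "t < 3 * pi / 2" using elim(1) by (auto simp: t_def algebra_simps)
    have "Im (rGamma z) = exp (- Re (ln_Gamma z)) * sin (t + real k * pi)"
      using Im_exp[of "- ln_Gamma z"] by (simp add: exp_minus_ln_Gamma[OF elim(2)] t_def)
    moreover have "sin (t + real k * pi) = sin t"
      using k by (simp add: sin_add sin_npi cos_npi)
    ultimately have st: "sin t > 0"
      using r(2)[OF elim(3,2)] by (simp add: zero_less_mult_iff)
    have "t > 0"
    proof (rule ccontr)
      assume "\<not> t > 0"
      then show False using st sin_ge_zero[of "- t"] t by simp
    qed
    moreover have "t < pi"
    proof (rule ccontr)
      assume "\<not> t < pi"
      then show False using st sin_ge_zero[of "t - pi"] t by (simp add: sin_diff)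
    qed
    ultimately show ?case
      unfolding gamma_strip_def by (auto simp: t_def algebra_simps)
  qed
qed

lemma eventually_at_real_within_upper_half_plane:
  assumes "\<forall>\<^sub>F z in at (complex_of_real p) within upper_half_plane. P z"
  obtains r where "r > 0" "\<And>z. Im z > 0 \<Longrightarrow> dist z (of_real p) < r \<Longrightarrow> P z"
proof -
  obtain d where d: "d > 0" "\<And>z. z \<in> upper_half_plane \<Longrightarrow> z \<noteq> of_real p \<and> dist z (of_real p) < d \<Longrightarrow> P z"
    using assms unfolding eventually_at by blast
  show ?thesis
  proof (rule that[OF d(1) d(2)])
    fix z :: complex assume "Im z > 0" "dist z (of_real p) < d"
    then show "z \<in> upper_half_plane" "z \<noteq> of_real p \<and> dist z (of_real p) < d"
      by (auto simp: upper_half_plane_def)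
  qed
qed

text \<open>The two half-lines in front of the slits are included because the argument of the branch
  approaches these lines as z approaches the real axis. The tips themselves are left out.\<close>

definition gamma_strip_slit :: "nat \<Rightarrow> complex set" where
  "gamma_strip_slit k = gamma_strip k
     \<union> {w. Im w = - (real k * pi) \<and> Re w < ln \<bar>Gamma (gamma_crit k)\<bar>}
     \<union> {w. Im w = - (real (Suc k) * pi) \<and> Re w < ln \<bar>Gamma (gamma_crit (Suc k))\<bar>}"

lemma connected_gamma_strip_slit: "connected (gamma_strip_slit k)"
proof (rule connected_intermediate_closure)
  have "gamma_strip k = {w. Im w > - (real (Suc k) * pi)} \<inter> {w. Im w < - (real k * pi)}"
    by (auto simp: gamma_strip_def)
  then show "connected (gamma_strip k)"
    by (auto intro!: convex_connected convex_Int convex_halfspace_Im_gt convex_halfspace_Im_lt)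
  show "gamma_strip k \<subseteq> gamma_strip_slit k" by (auto simp: gamma_strip_slit_def)
  have 1: "w \<in> closure (gamma_strip k)" if "Im w = - (real k * pi)" for w
    unfolding closure_approachable
  proof (intro allI impI)
    fix e :: real assume "e > 0"
    define d where "d = min (e / 2) (pi / 2)"
    have d: "0 < d" "d < pi" "d < e"
      using \<open>e > 0\<close> pi_gt_zero by (auto simp: d_def min_def)
    then have "w - \<i> * of_real d \<in> gamma_strip k"
      using that by (auto simp: gamma_strip_def algebra_simps)
    moreover have "dist (w - \<i> * of_real d) w < e"
      using d by (auto simp: dist_norm norm_mult)
    ultimately show "\<exists>y\<in>gamma_strip k. dist y w < e" by blast
  qed
  have 2: "w \<in> closure (gamma_strip k)" if "Im w = - (real (Suc k) * pi)" for w
    unfolding closure_approachable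
  proof (intro allI impI)
    fix e :: real assume "e > 0"
    define d where "d = min (e / 2) (pi / 2)"
    have d: "0 < d" "d < pi" "d < e"
      using \<open>e > 0\<close> pi_gt_zero by (auto simp: d_def min_def)
    then have "w + \<i> * of_real d \<in> gamma_strip k"
      using that by (auto simp: gamma_strip_def algebra_simps)
    moreover have "dist (w + \<i> * of_real d) w < e"
      using d by (auto simp: dist_norm norm_mult)
    ultimately show "\<exists>y\<in>gamma_strip k. dist y w < e" by blast
  qed
  show "gamma_strip_slit k \<subseteq> closure (gamma_strip k)"
    using 1 2 closure_subset[of "gamma_strip k"] by (auto simp: gamma_strip_slit_def)
qed

lemma open_ln_Gamma_image: "open (ln_Gamma ` upper_half_plane)"
  by (rule open_mapping_thm3[OF holomorphic_on_ln_Gamma_upper_half_plane open_upper_half_plane inj_on_ln_Gamma])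

lemma gamma_strip_slit_Im: "w \<in> gamma_strip_slit k \<Longrightarrow> Im w \<in> {- (real (Suc k) * pi)..0}"
  by (auto simp: gamma_strip_slit_def gamma_strip_def algebra_simps)
     (smt (verit) mult_nonneg_nonneg of_nat_0_le_iff pi_gt_zero)+

text \<open>The part of the set covered by the image is relatively open by the open mapping theorem.
  It is relatively closed because a limit of values is a value or a boundary value, and boundary
  values lie on the lines Im = - m pi at or behind the tips, hence outside the set.\<close>

lemma gamma_strip_slit_subset_image:
  assumes "even k"
  shows "gamma_strip_slit k \<subseteq> ln_Gamma ` upper_half_plane"
proof -
  let ?W = "gamma_strip_slit k" and ?T = "gamma_strip_slit k \<inter> ln_Gamma ` upper_half_plane"
  have "openin (top_of_set ?W) ?T"
    by (rule openin_open_Int[OF open_ln_Gamma_image])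
  moreover have "closedin (top_of_set ?W) ?T"
  proof -
    have "?W \<inter> closure ?T \<subseteq> ?T"
    proof
      fix l assume "l \<in> ?W \<inter> closure ?T"
      then obtain x where *: "(\<forall>n. x n \<in> ?T) \<and> x \<longlonglongrightarrow> l \<and> l \<in> ?W"
        by (auto simp: closure_sequential)
      then have "\<forall>n. \<exists>z. 0 < Im z \<and> x n = ln_Gamma z"
        by (auto simp: upper_half_plane_def)
      then obtain z where z: "\<And>n. 0 < Im (z n)" "\<And>n. x n = ln_Gamma (z n)" by metis
      have "Im (ln_Gamma (z n)) \<in> {- (real (Suc k) * pi)..0}" for n
        using * gamma_strip_slit_Im z(2) by (metis IntD1)
      moreover have "(\<lambda>n. ln_Gamma (z n)) \<longlonglongrightarrow> l" unfolding z(2)[symmetric] using * by blast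
      ultimately obtain y where "(0 < Im y \<and> ln_Gamma y = l) \<or> (\<exists>m x. x \<in> gamma_interval m \<and> y = of_real x \<and> l = ln_Gamma_bdry m x)"
        using ln_Gamma_limit_cases[of z "real (Suc k) * pi" l] z(1) by metis
      moreover have "l \<noteq> ln_Gamma_bdry m x" if x: "x \<in> gamma_interval m" for m x
      proof
        assume l: "l = ln_Gamma_bdry m x"
        have "\<not> (real k < real m \<and> real m < real (Suc k))" by simp
        then have "l \<notin> gamma_strip k" by (auto simp: l gamma_strip_def ln_Gamma_bdry_def)
        then have "(m = k \<or> m = Suc k) \<and> ln \<bar>Gamma x\<bar> < ln \<bar>Gamma (gamma_crit m)\<bar>"
          using * by (auto simp: gamma_strip_slit_def l ln_Gamma_bdry_def simp del: of_nat_Suc)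
        moreover have "\<bar>Gamma (gamma_crit m)\<bar> > 0"
          using Gamma_nonzero[OF gamma_interval_not_nonpos_Int[OF gamma_crit(1)]] by simp
        ultimately show False using abs_Gamma_gamma_crit_le[OF x] by (smt (verit) ln_le_cancel_iff)
      qed
      ultimately show "l \<in> ?T" using * by (auto simp: upper_half_plane_def)
    qed
    then have "?T = ?W \<inter> closure ?T" using closure_subset[of ?T] by blast
    then show ?thesis by (metis closedin_closed_Int closed_closure)
  qed
  moreover have "?T \<noteq> {}"
  proof -
    \<comment> \<open>Points just above the pole - k are mapped into the strip and make the covered
      part nonempty.\<close>
    obtain r where r: "r > 0" "\<And>z. Im z > 0 \<Longrightarrow> dist z (of_real (- real k)) < r \<Longrightarrow> ln_Gamma z \<in> gamma_strip k"
      using eventually_at_real_within_upper_half_plane[OF eventually_ln_Gamma_in_strip[OF assms gamma_crit_bounds]] by metis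
    have "ln_Gamma (of_real (- real k) + \<i> * of_real (r / 2)) \<in> gamma_strip k"
      by (rule r(2)) (use r(1) in \<open>auto simp: dist_norm norm_mult\<close>)
    then show ?thesis
      using r(1) by (auto simp: gamma_strip_slit_def upper_half_plane_def
          intro!: image_eqI[of _ _ "of_real (- real k) + \<i> * of_real (r / 2)"])
  qed
  ultimately have "?T = ?W"
    using connected_gamma_strip_slit[of k] unfolding connected_clopen by blast
  then show ?thesis by blast
qed

section \<open>The branches of the inverse\<close>

definition gamma_branch_log :: "nat \<Rightarrow> complex \<Rightarrow> complex" where
  "gamma_branch_log k z = Ln z - \<i> * of_real (real (Suc k) * pi)"

lemma gamma_branch_eq: "gamma_branch (int k) z = ln_Gamma_inv (gamma_branch_log k z)"
  by (simp add: gamma_branch_def gamma_branch_log_def algebra_simps)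

lemma gamma_branch_log_in_strip: "Im z > 0 \<Longrightarrow> gamma_branch_log k z \<in> gamma_strip k"
  using Im_Ln_pos_lt_imp[of z] by (auto simp: gamma_branch_log_def gamma_strip_def algebra_simps)

lemma exp_i_odd_pi: "even k \<Longrightarrow> exp (\<i> * of_real (real (Suc k) * pi)) = -1"
  unfolding cis_conv_exp[symmetric]
  using cos_npi[of "Suc k"] sin_npi[of "Suc k"] by (simp add: complex_eq_iff del: of_nat_Suc)

lemma gamma_strip_subset_image: "even k \<Longrightarrow> gamma_strip k \<subseteq> ln_Gamma ` upper_half_plane"
  using gamma_strip_slit_subset_image[of k] by (auto simp: gamma_strip_slit_def)

text \<open>For even k the shift is by an odd multiple of pi, which exponentiation turns into the
  minus sign.\<close>

lemma gamma_branch: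
  assumes "even k" "Im z > 0"
  shows "Im (gamma_branch (int k) z) > 0"
    and "ln_Gamma (gamma_branch (int k) z) = gamma_branch_log k z"
    and "Gamma (gamma_branch (int k) z) = - z"
proof -
  have *: "gamma_branch_log k z \<in> ln_Gamma ` upper_half_plane"
    using gamma_strip_subset_image gamma_branch_log_in_strip assms by blast
  show 1: "Im (gamma_branch (int k) z) > 0"
    using inv_into_into[OF *] by (simp add: gamma_branch_eq ln_Gamma_inv_def upper_half_plane_def)
  show 2: "ln_Gamma (gamma_branch (int k) z) = gamma_branch_log k z"
    using f_inv_into_f[OF *] by (simp add: gamma_branch_eq ln_Gamma_inv_def)
  have "z \<noteq> 0" using assms by auto
  then show "Gamma (gamma_branch (int k) z) = - z"
    using exp_ln_Gamma[OF 1] exp_i_odd_pi[OF assms(1)]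
    by (simp add: 2 gamma_branch_log_def exp_diff)
qed

text \<open>The shift moves the strip onto 0 < Im < pi, where \<open>Ln\<close> inverts
  \<open>exp\<close>. This is the criterion by which a solution of the Gamma equation is recognised
  as the value of this particular branch.\<close>

lemma gamma_branch_minus_Gamma:
  assumes "even k" "Im z > 0" "ln_Gamma z \<in> gamma_strip k"
  shows "gamma_branch (int k) (- Gamma z) = z"
proof -
  define w where "w = ln_Gamma z + \<i> * of_real (real (Suc k) * pi)"
  have Im: "0 < Im w" "Im w < pi"
    using assms(3) by (auto simp: w_def gamma_strip_def algebra_simps)
  have "exp w = - Gamma z"
    using exp_ln_Gamma[OF assms(2)] exp_i_odd_pi[OF assms(1)] by (simp add: w_def exp_add)
  then have "Ln (- Gamma z) = w"
    using Ln_exp[of w] Im by simp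
  then show ?thesis
    using assms(2) inv_into_f_f[OF inj_on_ln_Gamma, of z]
    by (simp add: gamma_branch_eq gamma_branch_log_def w_def ln_Gamma_inv_def upper_half_plane_def)
qed

lemma holomorphic_on_ln_Gamma_inv: "ln_Gamma_inv holomorphic_on ln_Gamma ` upper_half_plane"
proof -
  obtain h where h: "h holomorphic_on ln_Gamma ` upper_half_plane"
    "\<And>z. z \<in> upper_half_plane \<Longrightarrow> h (ln_Gamma z) = z"
    using holomorphic_has_inverse[OF holomorphic_on_ln_Gamma_upper_half_plane open_upper_half_plane
        inj_on_ln_Gamma] by metis
  show ?thesis
    by (rule holomorphic_transform[OF h(1)])
       (auto simp: ln_Gamma_inv_def h(2) inv_into_f_f[OF inj_on_ln_Gamma])
qed

lemma holomorphic_on_gamma_branch: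
  assumes "even k"
  shows "gamma_branch (int k) holomorphic_on upper_half_plane"
proof -
  have "gamma_branch_log k holomorphic_on upper_half_plane"
    unfolding gamma_branch_log_def
    by (intro holomorphic_intros) (auto simp: upper_half_plane_def complex_nonpos_Reals_iff)
  moreover have "gamma_branch_log k ` upper_half_plane \<subseteq> ln_Gamma ` upper_half_plane"
    using gamma_strip_subset_image[OF assms] gamma_branch_log_in_strip
    by (auto simp: upper_half_plane_def)
  ultimately have "(ln_Gamma_inv \<circ> gamma_branch_log k) holomorphic_on upper_half_plane"
    using holomorphic_on_compose_gen holomorphic_on_ln_Gamma_inv by blast
  then show ?thesis
    by (simp add: o_def gamma_branch_eq[abs_def])
qed

text \<open>The modulus of \<open>Gamma\<close> at the value of the branch is |z|, so the bound on
  preimages becomes a bound in terms of z.\<close>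

lemma gamma_branch_norm_le:
  assumes "even k"
  obtains A B where "A \<ge> 0" "B \<ge> 0"
    "\<And>z. Im z > 0 \<Longrightarrow> norm (gamma_branch (int k) z) \<le> A + B / sqrt (norm z)"
proof -
  obtain A B where AB: "A \<ge> 0" "B \<ge> 0" "\<And>w. 0 < Im w \<Longrightarrow>
      Im (ln_Gamma w) \<in> {- (real (Suc k) * pi)..0} \<Longrightarrow> norm w \<le> A + B / sqrt (norm (Gamma w))"
    using norm_le_of_Im_ln_Gamma_bounded by blast
  show ?thesis
  proof (rule that[OF AB(1,2)])
    fix z :: complex assume z: "Im z > 0"
    have "gamma_branch_log k z \<in> gamma_strip_slit k"
      using gamma_branch_log_in_strip[OF z] by (auto simp: gamma_strip_slit_def)
    then show "norm (gamma_branch (int k) z) \<le> A + B / sqrt (norm z)"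
      using AB(3)[OF gamma_branch(1)[OF assms z]] gamma_branch(2,3)[OF assms z] gamma_strip_slit_Im
      by simp
  qed
qed

text \<open>Through \<open>Gamma (gamma_branch k z) = - z\<close>, the open mapping theorem for the entire function
  \<open>rGamma\<close> controls the branch both at infinity (\<open>p = - k\<close>) and at the real points outside the
  support of the density.\<close>

lemma gamma_branch_near_regular_point:
  assumes k: "even k" and p: "gamma_crit (Suc k) < p" "p < gamma_crit k" and "e > 0"
  obtains d where "d > 0"
    "\<And>z. Im z > 0 \<Longrightarrow> dist (- inverse z) (of_real (rGamma p)) < d \<Longrightarrow>
      dist (gamma_branch (int k) z) (of_real p) < e"
proof -
  obtain D where D: "D > 0" "(rGamma has_field_derivative complex_of_real D) (at (complex_of_real p))"
    using rGamma_deriv_pos[OF k p] by metis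
  obtain r1 where r1: "r1 > 0" "\<And>z. z \<in> ball (of_real p) r1 \<Longrightarrow> Im z > 0 \<Longrightarrow> Im (rGamma z) > 0"
    using Im_rGamma_sign_near_real[OF D] by blast
  obtain r2 where r2: "r2 > 0"
    "\<And>z. Im z > 0 \<Longrightarrow> dist z (of_real p) < r2 \<Longrightarrow> ln_Gamma z \<in> gamma_strip k"
    using eventually_at_real_within_upper_half_plane[OF eventually_ln_Gamma_in_strip[OF k p]] by blast
  define r where "r = min e (min r1 r2)"
  have r: "r > 0" "r \<le> e" "r \<le> r1" "r \<le> r2" using \<open>e > 0\<close> r1(1) r2(1) by (auto simp: r_def)
  have "\<not> (rGamma :: complex \<Rightarrow> complex) constant_on UNIV"
  proof
    assume "(rGamma :: complex \<Rightarrow> complex) constant_on UNIV"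
    then have "rGamma (0::complex) = rGamma 1" unfolding constant_on_def by (metis UNIV_I)
    then show False by simp
  qed
  then have "open (rGamma ` ball (complex_of_real p) r)"
    by (intro open_mapping_thm[of rGamma UNIV] holomorphic_rGamma) auto
  moreover have "complex_of_real (rGamma p) \<in> rGamma ` ball (complex_of_real p) r"
    using r(1) by (auto simp: image_iff rGamma_complex_of_real intro!: bexI[of _ "complex_of_real p"])
  ultimately obtain d where d: "d > 0" "ball (complex_of_real (rGamma p)) d \<subseteq> rGamma ` ball (complex_of_real p) r"
    using openE by blast
  show ?thesis
  proof (rule that[OF d(1)])
    fix z :: complex assume z: "Im z > 0" "dist (- inverse z) (of_real (rGamma p)) < d"
    then obtain w where w: "dist w (of_real p) < r" "rGamma w = - inverse z"
      using d(2) by (force simp: dist_commute)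
    have "Im (rGamma w) > 0"
      using Im_inverse_less_0[OF z(1)] by (simp add: w(2) del: inverse_complex.simps)
    \<comment> \<open>The open mapping theorem provides w in the full disc only. Below the axis Im
      (rGamma w) would be negative by reflection, and on the axis it would vanish.\<close>
    moreover have "\<not> Im w < 0"
    proof
      assume "Im w < 0"
      moreover have "dist (cnj w) (of_real p) = dist w (of_real p)"
        using complex_mod_cnj[of "w - of_real p"] by (simp add: dist_norm)
      ultimately have "Im (rGamma (cnj w)) > 0"
        using r1(2)[of "cnj w"] w(1) r by (simp add: dist_commute)
      then show False using \<open>Im (rGamma w) > 0\<close> by (simp flip: cnj_rGamma)
    qed
    moreover have "Im w \<noteq> 0"
    proof
      assume "Im w = 0"
      then have "w = of_real (Re w)" by (simp add: complex_eq_iff)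
      then have "Im (rGamma w) = 0" by (metis rGamma_complex_of_real Im_complex_of_real)
      then show False using \<open>Im (rGamma w) > 0\<close> by simp
    qed
    ultimately have "Im w > 0" by linarith
    moreover from this have "ln_Gamma w \<in> gamma_strip k" using r2(2) w(1) r by auto
    moreover have "- Gamma w = z"
      using w(2) by (metis rGamma_inverse_Gamma inverse_inverse_eq inverse_minus_eq minus_minus)
    ultimately have "gamma_branch (int k) z = w"
      using gamma_branch_minus_Gamma[OF k] by metis
    then show "dist (gamma_branch (int k) z) (of_real p) < e" using w(1) r by simp
  qed
qed

lemma gamma_branch_at_infinity:
  assumes "even k" "e > 0"
  obtains R where "R > 0" "\<And>z. Im z > 0 \<Longrightarrow> norm z \<ge> R \<Longrightarrow> norm (gamma_branch (int k) z + of_nat k) < e"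
proof -
  obtain d where d: "d > 0" "\<And>z. Im z > 0 \<Longrightarrow> dist (- inverse z) (of_real (rGamma (- real k))) < d \<Longrightarrow>
      dist (gamma_branch (int k) z) (of_real (- real k)) < e"
    using gamma_branch_near_regular_point[OF assms(1) gamma_crit_bounds assms(2)] by blast
  show ?thesis
  proof (rule that[of "2 / d"])
    fix z :: complex assume z: "Im z > 0" "norm z \<ge> 2 / d"
    then have "norm z > 0" by auto
    moreover have "norm (inverse z) = inverse (norm z)"
      by (rule norm_inverse)
    moreover have "inverse (norm z) < d"
      using z(2) d(1) \<open>norm z > 0\<close> by (simp add: field_simps)
    ultimately have "norm (inverse z) < d" by simp
    then show "norm (gamma_branch (int k) z + of_nat k) < e"
      using d(2)[OF z(1)] by (simp add: dist_norm)
  qed (use d in auto)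
qed

lemma tendsto_gamma_branch_regular:
  assumes k: "even k" and p: "gamma_crit (Suc k) < p" "p < gamma_crit k" and s: "s \<noteq> 0" "rGamma p = - inverse s"
  shows "((\<lambda>y. gamma_branch (int k) (Complex s y)) \<longlongrightarrow> of_real p) (at_right 0)"
proof (rule tendstoI)
  fix e :: real assume "e > 0"
  then obtain d where d: "d > 0" "\<And>z. Im z > 0 \<Longrightarrow> dist (- inverse z) (of_real (rGamma p)) < d \<Longrightarrow>
      dist (gamma_branch (int k) z) (of_real p) < e"
    using gamma_branch_near_regular_point[OF k p] by blast
  have "((\<lambda>y. - inverse (Complex s y)) \<longlongrightarrow> - inverse (Complex s 0)) (at_right 0)"
    by (intro tendsto_intros) (use s in \<open>auto simp: complex_eq_iff\<close>)
  moreover have "- inverse (Complex s 0) = of_real (rGamma p)"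
    using s(2) by (simp flip: complex_of_real_def)
  ultimately have "\<forall>\<^sub>F y in at_right 0. dist (- inverse (Complex s y)) (of_real (rGamma p)) < d"
    using d(1) tendstoD by fastforce
  moreover have "\<forall>\<^sub>F y in at_right (0::real). y > 0" by (rule eventually_at_right_less)
  ultimately show "\<forall>\<^sub>F y in at_right 0. dist (gamma_branch (int k) (Complex s y)) (of_real p) < e"
    by eventually_elim (rule d(2), auto)
qed

section \<open>Boundary values of the branches on the real line\<close>

lemma tendsto_Ln_vertical:
  assumes "s \<noteq> 0"
  shows "((\<lambda>y. Ln (Complex s y)) \<longlongrightarrow> Complex (ln \<bar>s\<bar>) (if s < 0 then pi else 0)) (at_right 0)"
proof (cases "s < 0")
  case True
  have "((\<lambda>y. Ln (- Complex s y) + \<i> * pi) \<longlongrightarrow> Ln (- Complex s 0) + \<i> * pi) (at_right 0)"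
    by (intro tendsto_intros) (use True in \<open>auto simp: complex_nonpos_Reals_iff\<close>)
  moreover have "Ln (- Complex s 0) + \<i> * pi = Complex (ln \<bar>s\<bar>) (if s < 0 then pi else 0)"
    using True Ln_of_real[of "- s"] by (simp add: complex_eq_iff flip: complex_of_real_def)
  moreover have "\<forall>\<^sub>F y in at_right (0::real). Ln (- Complex s y) + \<i> * pi = Ln (Complex s y)"
    using eventually_at_right_less[of "0::real"]
  proof eventually_elim
    case (elim y)
    have "Complex s y \<noteq> 0" using True by (simp add: complex_eq_iff)
    then show ?case using elim Ln_minus[of "Complex s y"] by (simp split: if_splits)
  qed
  ultimately show ?thesis
    using Lim_transform_eventually by fastforce
next
  case False
  then have "((\<lambda>y. Ln (Complex s y)) \<longlongrightarrow> Ln (Complex s 0)) (at_right 0)"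
    by (intro tendsto_intros) (use False assms in \<open>auto simp: complex_nonpos_Reals_iff\<close>)
  moreover have "Ln (Complex s 0) = Complex (ln \<bar>s\<bar>) (if s < 0 then pi else 0)"
    using False assms Ln_of_real[of s] by (simp add: complex_eq_iff flip: complex_of_real_def)
  ultimately show ?thesis by simp
qed

text \<open>From above, the argument of s tends to pi for negative s and to 0 for positive s: the
  limit lies on the line of slit k or of slit k + 1, respectively.\<close>

lemma tendsto_gamma_branch_log:
  assumes "s \<noteq> 0"
  shows "((\<lambda>y. gamma_branch_log k (Complex s y)) \<longlongrightarrow>
    Complex (ln \<bar>s\<bar>) (- (real (if s < 0 then k else Suc k) * pi))) (at_right 0)"
proof -
  have "((\<lambda>y. gamma_branch_log k (Complex s y)) \<longlongrightarrow>
    Complex (ln \<bar>s\<bar>) (if s < 0 then pi else 0) - \<i> * of_real (real (Suc k) * pi)) (at_right 0)"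
    unfolding gamma_branch_log_def by (intro tendsto_diff tendsto_Ln_vertical assms tendsto_const)
  moreover have "Complex (ln \<bar>s\<bar>) (if s < 0 then pi else 0) - \<i> * of_real (real (Suc k) * pi)
      = Complex (ln \<bar>s\<bar>) (- (real (if s < 0 then k else Suc k) * pi))"
    by (simp add: complex_eq_iff algebra_simps)
  ultimately show ?thesis by simp
qed

text \<open>The imaginary part determines the number of the slit, and strict minimality of |Gamma|
  at the critical point then determines x.\<close>

lemma ln_Gamma_bdry_eq_tip_imp:
  assumes "x \<in> gamma_interval m" "ln_Gamma_bdry m x = ln_Gamma_bdry n (gamma_crit n)"
  shows "x = gamma_crit n"
proof -
  have mn: "m = n" and ln: "ln \<bar>Gamma x\<bar> = ln \<bar>Gamma (gamma_crit n)\<bar>"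
    using assms(2) by (auto simp: ln_Gamma_bdry_def)
  have "Gamma x \<noteq> 0" "Gamma (gamma_crit n) \<noteq> 0"
    using Gamma_nonzero gamma_interval_not_nonpos_Int assms(1) gamma_crit(1) by blast+
  then have "\<bar>Gamma x\<bar> = \<bar>Gamma (gamma_crit n)\<bar>"
    using ln by simp
  then show ?thesis
    using abs_Gamma_gamma_crit_less assms(1) mn by force
qed

text \<open>If the tip of a slit is not a value of \<open>ln_Gamma\<close>, then the critical point is the only
  possible limit of preimages by properness.\<close>

lemma tendsto_gamma_branch_tip:
  assumes k: "even k" and n: "n = (if s < 0 then k else Suc k)"
    and s: "s \<noteq> 0" "\<bar>s\<bar> = \<bar>Gamma (gamma_crit n)\<bar>"
    and tip: "ln_Gamma_bdry n (gamma_crit n) \<notin> ln_Gamma ` upper_half_plane"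
  shows "((\<lambda>y. gamma_branch (int k) (Complex s y)) \<longlongrightarrow> of_real (gamma_crit n)) (at_right 0)"
proof (rule tendsto_at_right_sequentially[OF zero_less_one])
  fix S :: "nat \<Rightarrow> real"
  assume S: "\<And>n. 0 < S n" "S \<longlonglongrightarrow> 0"
  let ?z = "\<lambda>j. gamma_branch (int k) (Complex s (S j))"
  have "filterlim S (at_right 0) sequentially"
    unfolding filterlim_at using S less_imp_neq[OF S(1)] by (auto intro!: always_eventually)
  from filterlim_compose[OF tendsto_gamma_branch_log[OF s(1), of k] this]
  have lim: "(\<lambda>j. ln_Gamma (?z j)) \<longlonglongrightarrow> ln_Gamma_bdry n (gamma_crit n)"
    using S(1) s(2) n by (simp add: gamma_branch(2)[OF k] ln_Gamma_bdry_def)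
  show "?z \<longlonglongrightarrow> of_real (gamma_crit n)"
  proof (rule tendstoI, rule ccontr)
    fix e :: real assume e: "e > 0" "\<not> (\<forall>\<^sub>F j in sequentially. dist (?z j) (of_real (gamma_crit n)) < e)"
    obtain r :: "nat \<Rightarrow> nat" where r: "strict_mono r" "\<And>j. \<not> dist (?z (r j)) (of_real (gamma_crit n)) < e"
      using not_eventually_sequentiallyD[OF e(2)] by blast
    have pos: "0 < Im (?z (r j))" for j
      using gamma_branch(1)[OF k] S(1) by simp
    have Im: "Im (ln_Gamma (?z (r j))) \<in> {- (real (Suc k) * pi)..0}" for j
    proof -
      have "gamma_branch_log k (Complex s (S (r j))) \<in> gamma_strip_slit k"
        using gamma_branch_log_in_strip S(1) by (simp add: gamma_strip_slit_def)
      then show ?thesis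
        using gamma_branch(2)[OF k] S(1) gamma_strip_slit_Im by simp
    qed
    have "(\<lambda>j. ln_Gamma (?z (r j))) \<longlonglongrightarrow> ln_Gamma_bdry n (gamma_crit n)"
      using LIMSEQ_subseq_LIMSEQ[OF lim r(1)] by (simp add: o_def)
    \<comment> \<open>A subsequence staying at distance e from the critical point still has a
      convergent subsequence. Its limit is not interior by \<open>tip\<close>, so it is the critical
      point after all.\<close>
    from ln_Gamma_limit_cases[of "\<lambda>j. ?z (r j)", OF pos Im this]
    obtain q l where q: "((\<lambda>j. ?z (r j)) \<circ> q) \<longlonglongrightarrow> l"
      and l: "(0 < Im l \<and> ln_Gamma l = ln_Gamma_bdry n (gamma_crit n)) \<or>
        (\<exists>m x. x \<in> gamma_interval m \<and> l = of_real x \<and> ln_Gamma_bdry n (gamma_crit n) = ln_Gamma_bdry m x)"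
      by metis
    from l tip have "l = of_real (gamma_crit n)"
      unfolding upper_half_plane_def
      using ln_Gamma_bdry_eq_tip_imp by (metis imageI mem_Collect_eq)
    then have "\<forall>\<^sub>F j in sequentially. dist (?z (r (q j))) (of_real (gamma_crit n)) < e"
      using tendstoD[OF q e(1)] by simp
    then show False using r(2) by (auto simp: eventually_sequentially)
  qed
qed

lemma tendsto_gamma_branch_bdry:
  assumes k: "even k" and s: "s \<noteq> 0" "s \<in> {- Gamma (gamma_crit k)..- Gamma (gamma_crit (Suc k))}"
  shows "((\<lambda>y. gamma_branch (int k) (Complex s y)) \<longlongrightarrow> gamma_branch_bdry (int k) s) (at_right 0)"
proof -
  define n where "n = (if s < 0 then k else Suc k)"
  define w where "w = Complex (ln \<bar>s\<bar>) (- (real n * pi))"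
  have signs: "Gamma (gamma_crit (Suc k)) < 0" "Gamma (gamma_crit k) > 0"
    using rGamma_gamma_crit_signs[OF k] by (auto simp: rGamma_inverse_Gamma)
  then have le: "\<bar>s\<bar> \<le> \<bar>Gamma (gamma_crit n)\<bar>" and n: "n = k \<or> n = Suc k"
    using s by (auto simp: n_def)
  have lim: "((\<lambda>y. gamma_branch_log k (Complex s y)) \<longlongrightarrow> w) (at_right 0)"
    using tendsto_gamma_branch_log[OF s(1), of k] by (simp add: w_def n_def)
  have "\<exists>l. ((\<lambda>y. gamma_branch (int k) (Complex s y)) \<longlongrightarrow> l) (at_right 0)"
  \<comment> \<open>The split is on membership of w in the image rather than on the size of |s|:
    inside the image continuity of the inverse suffices, and outside it w cannot lie in front of a
    slit, which forces it to be the tip.\<close>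
  proof (cases "w \<in> ln_Gamma ` upper_half_plane")
    case True
    have "isCont ln_Gamma_inv w"
      using holomorphic_on_imp_continuous_on[OF holomorphic_on_ln_Gamma_inv] open_ln_Gamma_image True
        continuous_on_eq_continuous_at by blast
    from isCont_tendsto_compose[OF this lim] show ?thesis
      by (auto simp: gamma_branch_eq)
  next
    case False
    then have "w \<notin> gamma_strip_slit k"
      using gamma_strip_slit_subset_image[OF k] by blast
    then have "\<not> ln \<bar>s\<bar> < ln \<bar>Gamma (gamma_crit n)\<bar>"
      using n by (auto simp: w_def gamma_strip_slit_def)
    then have eq: "\<bar>s\<bar> = \<bar>Gamma (gamma_crit n)\<bar>"
      using le s(1) by (smt (verit) ln_less_cancel_iff)
    then have "w = ln_Gamma_bdry n (gamma_crit n)"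
      by (simp add: w_def ln_Gamma_bdry_def)
    then show ?thesis
      using tendsto_gamma_branch_tip[OF k n_def s(1) eq] False by auto
  qed
  then show ?thesis
    unfolding gamma_branch_bdry_def by (metis tendsto_Lim trivial_limit_at_right_real)
qed

section \<open>Cauchy transforms and boundary values in a half plane\<close>

lemma integrable_on_inverse_sqrt_abs: "(\<lambda>s::real. 1 / sqrt \<bar>s\<bar>) integrable_on {c..d}"
proof -
  define R where "R = max \<bar>c\<bar> \<bar>d\<bar>"
  have "((\<lambda>s. s powr (-1/2)) has_integral R powr (-1/2 + 1) / (-1/2 + 1)) {0..R}"
    by (rule has_integral_powr_from_0) (auto simp: R_def)
  then have "(\<lambda>s. s powr (-1/2)) integrable_on {0..R}" by blast
  then have "(\<lambda>s. 1 / sqrt \<bar>s\<bar>) integrable_on {0..R}"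
    by (rule integrable_eq) (auto simp: powr_minus powr_half_sqrt divide_simps)
  moreover from this have "(\<lambda>s. 1 / sqrt \<bar>s\<bar>) integrable_on {- R..0}"
    using Henstock_Kurzweil_Integration.integrable_reflect_real[where f = "\<lambda>s. 1 / sqrt \<bar>s\<bar>" and a = 0 and b = R] by simp
  ultimately have "(\<lambda>s. 1 / sqrt \<bar>s\<bar>) integrable_on {- R..R}"
    by (intro Henstock_Kurzweil_Integration.integrable_combine[of "- R" 0 R]) (auto simp: R_def)
  then show ?thesis
    by (rule integrable_subinterval_real) (auto simp: R_def)
qed

lemma absolutely_integrable_mult_continuous:
  fixes f K :: "real \<Rightarrow> complex"
  assumes f: "f absolutely_integrable_on {c..d}" and K: "continuous_on {c..d} K"
  shows "(\<lambda>s. f s * K s) absolutely_integrable_on {c..d}"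
proof -
  have "(\<lambda>s. K s * f s) absolutely_integrable_on {c..d}"
  proof (rule absolutely_integrable_bounded_measurable_product[OF bilinear_times _ _ _ f])
    show "K \<in> borel_measurable (lebesgue_on {c..d})"
      by (rule continuous_imp_measurable_on_sets_lebesgue[OF K]) auto
    show "bounded (K ` {c..d})"
      by (intro compact_imp_bounded compact_continuous_image K) auto
  qed auto
  then show ?thesis by (simp add: mult.commute)
qed

text \<open>A direct estimate of the difference quotient: after subtracting the candidate
  derivative, the integrand is f t times (y - z) / ((y - t) (z - t)^2), which is uniformly small off
  the segment.\<close>

lemma holomorphic_on_Cauchy_transform:
  fixes f :: "real \<Rightarrow> complex"
  assumes f: "f absolutely_integrable_on {a..b}"
  shows "(\<lambda>z. integral {a..b} (\<lambda>t. f t / (z - of_real t))) holomorphic_on (- complex_of_real ` {a..b})"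
proof -
  let ?E = "\<lambda>z. integral {a..b} (\<lambda>t. f t / (z - of_real t))"
  have opn: "open (- complex_of_real ` {a..b})"
    by (intro open_Compl compact_imp_closed compact_continuous_image continuous_intros) auto
  have int: "(\<lambda>t. f t * K t) integrable_on {a..b}" if "continuous_on {a..b} K" for K
    using absolutely_integrable_mult_continuous[OF f that] set_lebesgue_integral_eq_integral(1) by blast
  have "\<exists>D. (?E has_field_derivative D) (at z)" if z: "z \<in> - complex_of_real ` {a..b}" for z
  proof -
    obtain r where r: "r > 0" "ball z r \<subseteq> - complex_of_real ` {a..b}"
      using opn z openE by blast
    have far: "r / 2 \<le> norm (y - of_real t)" if "t \<in> {a..b}" "dist y z < r / 2" for y t
    proof -
      have "complex_of_real t \<notin> ball z r" using r(2) that(1) by blast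
      then show ?thesis
        using that(2) norm_triangle_ineq[of "z - y" "y - of_real t"] by (simp add: dist_norm norm_minus_commute)
    qed
    define D where "D = integral {a..b} (\<lambda>t. - (f t / (z - of_real t)\<^sup>2))"
    \<comment> \<open>The third power stems from the three denominator factors, each of modulus at
      least r / 2.\<close>
    define M where "M = integral {a..b} (\<lambda>t. norm (f t)) / (r / 2) ^ 3"
    have fn: "(\<lambda>t. norm (f t)) integrable_on {a..b}"
      using f absolutely_integrable_on_def by blast
    have bnd: "norm ((?E y - ?E z) / (y - z) - D) \<le> M * norm (y - z)"
      if y: "y \<noteq> z" "dist y z < r / 2" for y
    proof -
      have nz: "y \<noteq> of_real t" "z \<noteq> of_real t" if "t \<in> {a..b}" for t
        using far[OF that y(2)] far[OF that, of z] r(1) by auto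
      have c: "continuous_on {a..b} (\<lambda>t. 1 / (y - of_real t))"
        "continuous_on {a..b} (\<lambda>t. 1 / (z - of_real t))"
        "continuous_on {a..b} (\<lambda>t. - (1 / (z - of_real t)\<^sup>2))"
        by (intro continuous_intros; simp add: nz)+
      have i: "(\<lambda>t. f t / (y - of_real t)) integrable_on {a..b}"
        "(\<lambda>t. f t / (z - of_real t)) integrable_on {a..b}"
        "(\<lambda>t. - (f t / (z - of_real t)\<^sup>2)) integrable_on {a..b}"
        using int[OF c(1)] int[OF c(2)] int[OF c(3)] by simp_all
      have "(?E y - ?E z) / (y - z) - D
          = integral {a..b} (\<lambda>t. (f t / (y - of_real t) - f t / (z - of_real t)) / (y - z)
              - - (f t / (z - of_real t)\<^sup>2))"
        unfolding D_def integral_diff[OF i(1,2), symmetric] integral_divide[symmetric]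
        by (intro integral_diff[symmetric] integrable_on_divide integrable_diff i)
      also have "\<dots> = integral {a..b} (\<lambda>t. f t * ((y - z) / ((y - of_real t) * (z - of_real t)\<^sup>2)))"
      proof (intro integral_cong)
        fix t assume t: "t \<in> {a..b}"
        have *: "y - of_real t \<noteq> 0" "z - of_real t \<noteq> 0" "y - z \<noteq> 0" using nz[OF t] y by auto
        show "(f t / (y - of_real t) - f t / (z - of_real t)) / (y - z) - - (f t / (z - of_real t)\<^sup>2)
            = f t * ((y - z) / ((y - of_real t) * (z - of_real t)\<^sup>2))"
          using * by (simp add: divide_simps power2_eq_square) (simp add: algebra_simps)
      qed
      also have "norm \<dots> \<le> integral {a..b} (\<lambda>t. norm (f t) * (norm (y - z) / (r / 2) ^ 3))"
      proof (rule integral_norm_bound_integral)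
        show "(\<lambda>t. f t * ((y - z) / ((y - of_real t) * (z - of_real t)\<^sup>2))) integrable_on {a..b}"
          by (intro int continuous_intros) (use nz in auto)
        show "(\<lambda>t. norm (f t) * (norm (y - z) / (r / 2) ^ 3)) integrable_on {a..b}"
          by (intro integrable_on_mult_left fn)
        fix t assume t: "t \<in> {a..b}"
        have "(r / 2) ^ 3 = r / 2 * (r / 2)\<^sup>2" by (simp add: power2_eq_square power3_eq_cube)
        also have "\<dots> \<le> norm (y - of_real t) * (norm (z - of_real t))\<^sup>2"
          using far[OF t y(2)] far[OF t, of z] r(1) by (intro mult_mono power_mono) auto
        finally show "norm (f t * ((y - z) / ((y - of_real t) * (z - of_real t)\<^sup>2)))
            \<le> norm (f t) * (norm (y - z) / (r / 2) ^ 3)"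
          unfolding norm_mult norm_divide norm_power
          using r(1) by (intro mult_left_mono frac_le) auto
      qed
      also have "\<dots> = M * norm (y - z)"
        by (simp add: M_def)
      finally show ?thesis .
    qed
    have "((\<lambda>y. (?E y - ?E z) / (y - z) - D) \<longlongrightarrow> 0) (at z)"
    proof (rule Lim_null_comparison)
      show "\<forall>\<^sub>F y in at z. norm ((?E y - ?E z) / (y - z) - D) \<le> M * norm (y - z)"
        unfolding eventually_at using bnd r(1) by (intro exI[of _ "r / 2"]) auto
      have "((\<lambda>y. M * norm (y - z)) \<longlongrightarrow> M * norm (z - z)) (at z)"
        by (intro tendsto_intros)
      then show "((\<lambda>y. M * norm (y - z)) \<longlongrightarrow> 0) (at z)" by simp
    qed
    then show ?thesis
      unfolding has_field_derivative_iff Lim_null[symmetric] by blast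
  qed
  then show ?thesis
    by (simp add: holomorphic_on_open[OF opn])
qed

text \<open>Cauchy's formula on the rectangle with corners \<open>- R\<close> and \<open>R + \<i>R\<close>, for the translate of \<open>F\<close> by
  \<open>\<epsilon>\<i>\<close>.\<close>

lemma half_plane_Cauchy_rectangle:
  fixes F :: "complex \<Rightarrow> complex"
  assumes hol: "F holomorphic_on upper_half_plane"
    and \<epsilon>: "\<epsilon> > 0" and R: "R > 0" "norm z \<le> R / 2" and z: "Im z \<noteq> 0"
    and small: "\<And>w. Im w > 0 \<Longrightarrow> norm w \<ge> R \<Longrightarrow> norm (F w) \<le> \<eta>"
  shows "norm (integral {- R..R} (\<lambda>s. F (Complex s \<epsilon>) / (of_real s - z))
      - (if Im z > 0 then 2 * pi * \<i> * F (z + \<i> * of_real \<epsilon>) else 0)) \<le> 8 * \<eta>"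
proof -
  define f where "f = (\<lambda>w. F (w + \<i> * of_real \<epsilon>) / (w - z))"
  define v where "v = (if Im z > 0 then 2 * pi * \<i> * F (z + \<i> * of_real \<epsilon>) else 0)"
  define p1 p2 p3 p4 where "p1 = complex_of_real (- R)" and "p2 = complex_of_real R"
    and "p3 = Complex R R" and "p4 = Complex (- R) R"
  have rect: "rectpath p1 p3 = linepath p1 p2 +++ linepath p2 p3 +++ linepath p3 p4 +++ linepath p4 p1"
    by (simp add: rectpath_def Let_def p1_def p2_def p3_def p4_def Complex_eq)
  have holF: "(\<lambda>w. F (w + \<i> * of_real \<epsilon>)) holomorphic_on {w. Im w > - \<epsilon>}"
    by (rule holomorphic_on_compose_gen[OF _ hol, of "\<lambda>w. w + \<i> * of_real \<epsilon>", unfolded o_def])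
       (auto intro!: holomorphic_intros simp: upper_half_plane_def)
  have zR: "\<bar>Re z\<bar> \<le> R / 2" "\<bar>Im z\<bar> \<le> R / 2"
    using R(2) abs_Re_le_cmod[of z] abs_Im_le_cmod[of z] by linarith+
  have img: "path_image (rectpath p1 p3) = {z. Re z \<in> {- R, R} \<and> Im z \<in> {0..R}} \<union>
           {z. Im z \<in> {0, R} \<and> Re z \<in> {- R..R}}"
    using R by (subst path_image_rectpath) (auto simp: p1_def p3_def)
  have int: "(f has_contour_integral v) (rectpath p1 p3)"
  proof (cases "Im z > 0")
    case True
    have "z \<in> box p1 p3"
      using zR True R z by (auto simp: in_box_complex_iff p1_def p3_def)
    then have "winding_number (rectpath p1 p3) z = 1" by (rule winding_number_rectpath)
    moreover have "(f has_contour_integral (2 * pi * \<i> * winding_number (rectpath p1 p3) z * F (z + \<i> * of_real \<epsilon>))) (rectpath p1 p3)"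
      unfolding f_def
    proof (rule Cauchy_integral_formula_convex_simple[OF _ holF])
      show "convex {w. Im w > - \<epsilon>}" by (rule convex_halfspace_Im_gt)
      show "z \<in> interior {w. Im w > - \<epsilon>}"
        using True \<epsilon> by (subst interior_open[OF open_halfspace_Im_gt]) auto
      show "path_image (rectpath p1 p3) \<subseteq> {w. - \<epsilon> < Im w} - {z}"
        unfolding img using zR True \<epsilon> R by auto
    qed auto
    ultimately show ?thesis using True by (simp add: v_def)
  next
    case False
    \<comment> \<open>The half plane above the level of z contains the rectangle but not the
      pole.\<close>
    have "(f has_contour_integral 0) (rectpath p1 p3)"
    proof (rule Cauchy_theorem_convex_simple)
      have "f holomorphic_on {w. Im w > - \<epsilon>} \<inter> {w. Im w > Im z}"
        unfolding f_def
        by (intro holomorphic_on_divide holomorphic_on_subset[OF holF] holomorphic_intros) auto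
      then show "f holomorphic_on {w. Im w > - \<epsilon>} \<inter> {w. Im w > Im z}" .
      show "convex ({w. Im w > - \<epsilon>} \<inter> {w. Im w > Im z})"
        by (intro convex_Int convex_halfspace_Im_gt)
      show "path_image (rectpath p1 p3) \<subseteq> {w. Im w > - \<epsilon>} \<inter> {w. Im w > Im z}"
        unfolding img using False z \<epsilon> R by auto
    qed auto
    then show ?thesis using False by (simp add: v_def)
  qed
  then have ci: "f contour_integrable_on rectpath p1 p3"
    by (rule has_contour_integral_integrable)
  then have ci': "f contour_integrable_on linepath p1 p2" "f contour_integrable_on linepath p2 p3"
    "f contour_integrable_on linepath p3 p4" "f contour_integrable_on linepath p4 p1"
    unfolding rect by auto
  then have sum: "v = contour_integral (linepath p1 p2) f + (contour_integral (linepath p2 p3) f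
      + (contour_integral (linepath p3 p4) f + contour_integral (linepath p4 p1) f))"
    using contour_integral_unique[OF int] unfolding rect by simp
  \<comment> \<open>Away from the real axis |w - z| \<ge> R / 2, and the upward shift does not
    decrease |w|. The sides of lengths R, 2 R and R then contribute 2 \<eta>, 4 \<eta> and 2 \<eta>,
    which add up to the constant 8.\<close>
  have side: "norm (f w) \<le> \<eta> / (R / 2)" if "norm w \<ge> R" "Im w \<ge> 0" for w
  proof -
    have "norm w \<le> norm (w + \<i> * of_real \<epsilon>)"
      unfolding cmod_def using that \<epsilon> by (auto intro!: power_mono)
    then have "norm (F (w + \<i> * of_real \<epsilon>)) \<le> \<eta>"
      using that \<epsilon> by (intro small) auto
    moreover have "norm (w - z) \<ge> R / 2"
      using norm_triangle_ineq2[of w z] that R by linarith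
    ultimately show ?thesis
      unfolding f_def norm_divide using R by (intro frac_le) (auto intro: order_trans[OF norm_ge_zero])
  qed
  have \<eta>: "\<eta> \<ge> 0"
  proof -
    have "norm (F (Complex R R)) \<le> \<eta>"
      by (rule small) (use R abs_Re_le_cmod[of "Complex R R"] in auto)
    then show ?thesis using norm_ge_zero order_trans by blast
  qed
  have "norm (contour_integral (linepath p2 p3) f) \<le> \<eta> / (R / 2) * norm (p3 - p2)"
  proof (rule contour_integral_bound_linepath[OF ci'(2)])
    fix w assume "w \<in> closed_segment p2 p3"
    then obtain t where t: "0 \<le> t" "t \<le> 1" "w = (1 - t) *\<^sub>R p2 + t *\<^sub>R p3"
      by (auto simp: closed_segment_def)
    then have "Re w = R" "Im w \<ge> 0"
      using R unfolding t(3) by (auto simp: p2_def p3_def algebra_simps mult_left_le_one_le)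
    then show "norm (f w) \<le> \<eta> / (R / 2)" using side[of w] abs_Re_le_cmod[of w] by auto
  qed (use R \<eta> in auto)
  also have "\<dots> = 2 * \<eta>" using R by (simp add: p2_def p3_def cmod_def)
  finally have 2: "norm (contour_integral (linepath p2 p3) f) \<le> 2 * \<eta>" .
  have "norm (contour_integral (linepath p3 p4) f) \<le> \<eta> / (R / 2) * norm (p4 - p3)"
  proof (rule contour_integral_bound_linepath[OF ci'(3)])
    fix w assume "w \<in> closed_segment p3 p4"
    then obtain t where t: "0 \<le> t" "t \<le> 1" "w = (1 - t) *\<^sub>R p3 + t *\<^sub>R p4"
      by (auto simp: closed_segment_def)
    then have "Im w = R"
      using R unfolding t(3) by (auto simp: p3_def p4_def algebra_simps mult_left_le_one_le)
    then show "norm (f w) \<le> \<eta> / (R / 2)" using side[of w] abs_Im_le_cmod[of w] R by auto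
  qed (use R \<eta> in auto)
  also have "\<dots> = 4 * \<eta>" using R by (simp add: p3_def p4_def cmod_def real_sqrt_mult)
  finally have 3: "norm (contour_integral (linepath p3 p4) f) \<le> 4 * \<eta>" .
  have "norm (contour_integral (linepath p4 p1) f) \<le> \<eta> / (R / 2) * norm (p1 - p4)"
  proof (rule contour_integral_bound_linepath[OF ci'(4)])
    fix w assume "w \<in> closed_segment p4 p1"
    then obtain t where t: "0 \<le> t" "t \<le> 1" "w = (1 - t) *\<^sub>R p4 + t *\<^sub>R p1"
      by (auto simp: closed_segment_def)
    then have "Re w = - R" "Im w \<ge> 0"
      using R unfolding t(3) by (auto simp: p4_def p1_def algebra_simps mult_left_le_one_le)
    then show "norm (f w) \<le> \<eta> / (R / 2)" using side[of w] abs_Re_le_cmod[of w] by auto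
  qed (use R \<eta> in auto)
  also have "\<dots> = 2 * \<eta>" using R by (simp add: p4_def p1_def cmod_def)
  finally have 4: "norm (contour_integral (linepath p4 p1) f) \<le> 2 * \<eta>" .
  have "contour_integral (linepath p1 p2) f = integral {- R..R} (\<lambda>s. f (of_real s))"
    by (subst contour_integral_linepath_Reals_eq) (use R in \<open>auto simp: p1_def p2_def\<close>)
  also have "\<dots> = integral {- R..R} (\<lambda>s. F (Complex s \<epsilon>) / (of_real s - z))"
    by (simp add: f_def Complex_eq)
  finally have 1: "integral {- R..R} (\<lambda>s. F (Complex s \<epsilon>) / (of_real s - z)) - v
      = - (contour_integral (linepath p2 p3) f
      + (contour_integral (linepath p3 p4) f + contour_integral (linepath p4 p1) f))"
    using sum by (simp add: algebra_simps)
  have "norm (integral {- R..R} (\<lambda>s. F (Complex s \<epsilon>) / (of_real s - z)) - v) \<le> 2 * \<eta> + (4 * \<eta> + 2 * \<eta>)"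
    unfolding 1 norm_minus_cancel using 2 3 4 by (intro norm_triangle_le add_mono) auto
  then show ?thesis by (simp add: v_def)
qed

lemma continuous_on_horizontal:
  fixes F :: "complex \<Rightarrow> complex"
  assumes "F holomorphic_on upper_half_plane" "\<epsilon> > 0"
  shows "continuous_on S (\<lambda>s. F (Complex s \<epsilon>))"
  unfolding Complex_eq
  by (rule continuous_on_compose2[OF holomorphic_on_imp_continuous_on[OF assms(1)]])
     (use assms(2) in \<open>auto intro!: continuous_intros simp: upper_half_plane_def\<close>)

text \<open>Subtracting the conjugate of Cauchy's formula at \<open>cnj z\<close> (which has the value 0) leaves only the
  imaginary part of the boundary values.\<close>

lemma half_plane_Cauchy_Im:
  fixes F :: "complex \<Rightarrow> complex"
  assumes hol: "F holomorphic_on upper_half_plane"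
    and \<epsilon>: "\<epsilon> > 0" and R: "R > 0" "norm z \<le> R / 2" and z: "Im z > 0"
    and small: "\<And>w. Im w > 0 \<Longrightarrow> norm w \<ge> R \<Longrightarrow> norm (F w) \<le> \<eta>"
  shows "norm (integral {- R..R} (\<lambda>s. of_real (Im (F (Complex s \<epsilon>))) / (of_real s - z))
      - pi * F (z + \<i> * of_real \<epsilon>)) \<le> 8 * \<eta>"
proof -
  define P Q where "P = integral {- R..R} (\<lambda>s. F (Complex s \<epsilon>) / (of_real s - z))"
    and "Q = integral {- R..R} (\<lambda>s. F (Complex s \<epsilon>) / (of_real s - cnj z))"
  define X where "X = integral {- R..R} (\<lambda>s. of_real (Im (F (Complex s \<epsilon>))) / (of_real s - z))"
  have nz: "of_real s \<noteq> z" "of_real s \<noteq> cnj z" for s using z by (auto simp: complex_eq_iff)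
  have "norm (P - 2 * pi * \<i> * F (z + \<i> * of_real \<epsilon>)) \<le> 8 * \<eta>"
    using half_plane_Cauchy_rectangle[OF hol \<epsilon> R _ small] z by (simp add: P_def)
  moreover have "norm (cnj Q) \<le> 8 * \<eta>"
    using half_plane_Cauchy_rectangle[OF hol \<epsilon> R(1), of "cnj z"] R z small by (simp add: Q_def)
  moreover have "P - cnj Q = 2 * \<i> * X"
  proof -
    have "P - cnj Q = integral {- R..R} (\<lambda>s. F (Complex s \<epsilon>) / (of_real s - z)
        - cnj (F (Complex s \<epsilon>)) / (of_real s - z))"
      unfolding P_def Q_def integral_cnj
      by (subst integral_diff[symmetric])
         (auto intro!: integrable_continuous_real continuous_intros continuous_on_horizontal[OF hol \<epsilon>] simp: nz)
    also have "\<dots> = integral {- R..R} (\<lambda>s. 2 * \<i> * (of_real (Im (F (Complex s \<epsilon>))) / (of_real s - z)))"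
      by (intro integral_cong) (simp add: complex_diff_cnj flip: diff_divide_distrib)
    finally show ?thesis by (simp only: integral_mult_right X_def)
  qed
  ultimately have "norm (2 * \<i> * X - 2 * pi * \<i> * F (z + \<i> * of_real \<epsilon>)) \<le> 16 * \<eta>"
    using norm_triangle_ineq4[of "P - 2 * pi * \<i> * F (z + \<i> * of_real \<epsilon>)" "cnj Q"]
    by (simp add: algebra_simps)
  moreover have "2 * \<i> * X - 2 * pi * \<i> * F (z + \<i> * of_real \<epsilon>) = 2 * \<i> * (X - pi * F (z + \<i> * of_real \<epsilon>))"
    by (simp add: algebra_simps)
  ultimately show ?thesis
    by (simp add: norm_mult X_def)
qed

text \<open>The hypotheses isolate what the Cauchy argument takes from the branch: decay disposes of
  the far sides of the rectangle, and the inverse square root bound dominates the integrals near the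
  origin. No limit is assumed at s = 0, where the branch is unbounded.\<close>

locale half_plane_boundary =
  fixes F :: "complex \<Rightarrow> complex" and u :: "real \<Rightarrow> real" and A B c d :: real
  assumes hol: "F holomorphic_on upper_half_plane"
    and AB: "A \<ge> 0" "B \<ge> 0"
    and bound: "\<And>z. Im z > 0 \<Longrightarrow> norm (F z) \<le> A + B / sqrt (norm z)"
    and decay: "\<And>e. e > 0 \<Longrightarrow> \<exists>R. \<forall>z. Im z > 0 \<longrightarrow> norm z \<ge> R \<longrightarrow> norm (F z) \<le> e"
    and lim: "\<And>s. s \<noteq> 0 \<Longrightarrow> ((\<lambda>y. Im (F (Complex s y))) \<longlongrightarrow> u s) (at_right 0)"
    and supp: "\<And>s. s \<noteq> 0 \<Longrightarrow> s \<notin> {c..d} \<Longrightarrow> u s = 0"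
    and cd: "c < 0" "0 < d"
begin

definition eps :: "nat \<Rightarrow> real" where "eps n = inverse (real (Suc n))"

lemma eps_pos: "eps n > 0"
  by (simp add: eps_def)

lemma eps_filterlim: "filterlim eps (at_right 0) sequentially"
  using LIMSEQ_inverse_real_of_nat eps_pos
  by (auto simp: filterlim_at eps_def[abs_def] intro!: always_eventually)

lemma Im_bound: "s \<noteq> 0 \<Longrightarrow> \<bar>Im (F (Complex s (eps n)))\<bar> \<le> A + B / sqrt \<bar>s\<bar>"
proof -
  assume s: "s \<noteq> 0"
  have "\<bar>Im (F (Complex s (eps n)))\<bar> \<le> A + B / sqrt (norm (Complex s (eps n)))"
    using bound[of "Complex s (eps n)"] eps_pos abs_Im_le_cmod order_trans by fastforce
  also have "B / sqrt (norm (Complex s (eps n))) \<le> B / sqrt \<bar>s\<bar>"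
    using AB s abs_Re_le_cmod[of "Complex s (eps n)"] by (intro frac_le) auto
  finally show ?thesis by simp
qed

text \<open>Dominated convergence: since |s + \<i> y| \<ge> |s|, the majorant from
  \<open>Im_bound\<close> is the same for all heights and integrable across 0.\<close>

lemma kernel_limit:
  fixes K :: "real \<Rightarrow> complex"
  assumes K: "continuous_on {- R..R} K"
  shows "(\<lambda>s. of_real (u s) * K s) absolutely_integrable_on {- R..R}"
    and "(\<lambda>n. integral {- R..R} (\<lambda>s. of_real (Im (F (Complex s (eps n)))) * K s))
      \<longlonglongrightarrow> integral {- R..R} (\<lambda>s. of_real (u s) * K s)"
proof -
  have "bounded (K ` {- R..R})"
    by (intro compact_imp_bounded compact_continuous_image K) auto
  then obtain M where M: "M > 0" "\<And>s. s \<in> {- R..R} \<Longrightarrow> norm (K s) \<le> M"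
    unfolding bounded_pos by auto
  \<comment> \<open>At s = 0 the integrands are reset to 0: no limit is known there, and because
    division by 0 yields 0 the majorant could fail at that point. A single point does not affect the
    integrals.\<close>
  define f where "f = (\<lambda>n s. if s = 0 then 0 else of_real (Im (F (Complex s (eps n)))) * K s)"
  define g where "g = (\<lambda>s. if s = 0 then 0 else of_real (u s) * K s)"
  define h where "h = (\<lambda>s. (A + B * (1 / sqrt \<bar>s\<bar>)) * M)"
  have neg: "negligible {0::real}" by simp
  have hint: "h integrable_on {- R..R}"
    unfolding h_def
    by (intro integrable_on_mult_left integrable_add integrable_on_mult_right integrable_on_inverse_sqrt_abs)
       auto
  have fint: "f n integrable_on {- R..R}" for n
  proof (rule integrable_spike[OF _ neg])
    show "(\<lambda>s. of_real (Im (F (Complex s (eps n)))) * K s) integrable_on {- R..R}"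
      by (intro integrable_continuous_real continuous_intros K continuous_on_horizontal[OF hol eps_pos])
  qed (auto simp: f_def)
  have le: "norm (f n s) \<le> h s" if "s \<in> {- R..R}" for n s
  proof (cases "s = 0")
    case False
    then show ?thesis
      unfolding f_def h_def using Im_bound[OF False, of n] M(2)[OF that] AB M(1)
      by (auto simp: norm_mult intro!: mult_mono)
  qed (use AB M in \<open>auto simp: f_def h_def\<close>)
  have conv: "(\<lambda>n. f n s) \<longlonglongrightarrow> g s" for s
  proof (cases "s = 0")
    case False
    then show ?thesis
      unfolding f_def g_def using filterlim_compose[OF lim[OF False] eps_filterlim]
      by (auto intro!: tendsto_intros)
  qed (simp add: f_def g_def)
  note dc = dominated_convergence[OF fint hint le conv]
  have "norm (g s) \<le> h s" if "s \<in> {- R..R}" for s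
    by (rule tendsto_upperbound[OF tendsto_norm[OF conv]]) (use le[OF that] in auto)
  then have "g absolutely_integrable_on {- R..R}"
    by (rule absolutely_integrable_integrable_bound[OF _ dc(1) hint])
  then show "(\<lambda>s. of_real (u s) * K s) absolutely_integrable_on {- R..R}"
    by (rule absolutely_integrable_spike[OF _ neg]) (auto simp: g_def)
  have "integral {- R..R} g = integral {- R..R} (\<lambda>s. of_real (u s) * K s)"
    by (rule integral_spike[OF neg]) (auto simp: g_def)
  moreover have "integral {- R..R} (f n) = integral {- R..R} (\<lambda>s. of_real (Im (F (Complex s (eps n)))) * K s)" for n
    by (rule integral_spike[OF neg]) (auto simp: f_def)
  ultimately show "(\<lambda>n. integral {- R..R} (\<lambda>s. of_real (Im (F (Complex s (eps n)))) * K s))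
      \<longlonglongrightarrow> integral {- R..R} (\<lambda>s. of_real (u s) * K s)"
    using dc(2) by simp
qed

lemma absolutely_integrable_kernel:
  fixes K :: "real \<Rightarrow> complex"
  assumes K: "continuous_on {c..d} K"
  shows "(\<lambda>s. of_real (u s) * K s) absolutely_integrable_on {c..d}"
proof -
  have "(\<lambda>s. complex_of_real (u s) * 1) absolutely_integrable_on {- max \<bar>c\<bar> \<bar>d\<bar>..max \<bar>c\<bar> \<bar>d\<bar>}"
    by (rule kernel_limit) auto
  then have "(\<lambda>s. complex_of_real (u s)) absolutely_integrable_on {c..d}"
    unfolding mult_1_right by (rule absolutely_integrable_on_subinterval) auto
  then show ?thesis by (rule absolutely_integrable_mult_continuous[OF _ K])
qed

lemma representation:
  assumes z: "Im z > 0"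
  shows "F z = integral {c..d} (\<lambda>s. of_real (u s) / (of_real s - z)) / pi"
proof -
  define E where "E = integral {c..d} (\<lambda>s. of_real (u s) / (of_real s - z))"
  have "norm (E - pi * F z) \<le> e" if e: "e > 0" for e
  proof -
    obtain R0 where R0: "\<And>w. Im w > 0 \<Longrightarrow> norm w \<ge> R0 \<Longrightarrow> norm (F w) \<le> e / 8"
      using decay[of "e / 8"] e by auto
    \<comment> \<open>R depends on e but not on n, so the same error bound holds at every height and
      survives the limit in n. R also covers the support, so restricting the limit integral to it
      loses nothing.\<close>
    define R where "R = Max {1, R0, 2 * norm z, \<bar>c\<bar>, \<bar>d\<bar>}"
    have R: "R \<ge> 1" "R \<ge> R0" "R \<ge> 2 * norm z" "R \<ge> \<bar>c\<bar>" "R \<ge> \<bar>d\<bar>"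
      unfolding R_def by (intro Max_ge; simp)+
    define K where "K = (\<lambda>s::real. 1 / (of_real s - z))"
    have nz: "of_real s \<noteq> z" for s using z by (auto simp: complex_eq_iff)
    have K: "continuous_on {- R..R} K"
      unfolding K_def by (intro continuous_intros) (simp add: nz)
    have "norm (integral {- R..R} (\<lambda>s. of_real (Im (F (Complex s (eps n)))) * K s)
        - pi * F (z + \<i> * of_real (eps n))) \<le> e" for n
      using half_plane_Cauchy_Im[OF hol eps_pos, of R z "e / 8" n] R R0 z by (simp add: K_def)
    moreover have "(\<lambda>n. norm (integral {- R..R} (\<lambda>s. of_real (Im (F (Complex s (eps n)))) * K s)
        - pi * F (z + \<i> * of_real (eps n))))
      \<longlonglongrightarrow> norm (integral {- R..R} (\<lambda>s. of_real (u s) * K s) - pi * F (z + \<i> * of_real 0))"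
    proof (intro tendsto_intros kernel_limit(2)[OF K])
      have "isCont F (z + \<i> * of_real 0)"
        using holomorphic_on_imp_continuous_on[OF hol] z continuous_on_eq_continuous_at[OF open_upper_half_plane]
        by (auto simp: upper_half_plane_def)
      moreover have "eps \<longlonglongrightarrow> 0" using eps_filterlim by (simp add: filterlim_at)
      then have "(\<lambda>n. z + \<i> * of_real (eps n)) \<longlonglongrightarrow> z + \<i> * of_real 0"
        by (intro tendsto_intros)
      ultimately show "(\<lambda>n. F (z + \<i> * of_real (eps n))) \<longlonglongrightarrow> F (z + \<i> * of_real 0)"
        by (rule isCont_tendsto_compose)
    qed
    ultimately have "norm (integral {- R..R} (\<lambda>s. of_real (u s) * K s) - pi * F (z + \<i> * of_real 0)) \<le> e"
      by (intro tendsto_upperbound[OF _ always_eventually]) auto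
    moreover have "integral {- R..R} (\<lambda>s. of_real (u s) * K s) = integral {c..d} (\<lambda>s. of_real (u s) * K s)"
    proof (rule integral_spike_set)
      have "u s = 0" if "s \<notin> {c..d}" for s
        using supp[of s] that cd by (cases "s = 0") auto
      then have "{s \<in> {- R..R} - {c..d}. of_real (u s) * K s \<noteq> 0} = {}"
        by auto
      then show "negligible {s \<in> {- R..R} - {c..d}. of_real (u s) * K s \<noteq> 0}" by (simp only: negligible_empty)
      have "{s \<in> {c..d} - {- R..R}. of_real (u s) * K s \<noteq> 0} = {}"
        using R by auto
      then show "negligible {s \<in> {c..d} - {- R..R}. of_real (u s) * K s \<noteq> 0}" by (simp only: negligible_empty)
    qed
    ultimately show ?thesis by (simp add: E_def K_def)
  qed
  then have "norm (E - pi * F z) \<le> 0" by (rule field_le_epsilon[where y = 0, simplified])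
  then have "E = pi * F z" by simp
  then show ?thesis by (simp add: E_def)
qed

end

section \<open>The integral representation\<close>

lemma inv_into_Gamma:
  fixes t :: real
  assumes k: "even k"
    and t: "t \<in> {..<Gamma (gamma_crit (Suc k))} \<union> {Gamma (gamma_crit k)<..}"
  defines "x \<equiv> inv_into ({gamma_crit (Suc k)<..<- real k} \<union> {- real k<..<gamma_crit k}) Gamma t"
  shows "gamma_crit (Suc k) < x" "x < gamma_crit k" "rGamma x = inverse t"
proof -
  have t': "t \<in> Gamma ` ({gamma_crit (Suc k)<..<- real k} \<union> {- real k<..<gamma_crit k})"
    using bij_betw_Gamma[OF k] t by (simp add: bij_betw_def)
  show "gamma_crit (Suc k) < x" "x < gamma_crit k"
    using inv_into_into[OF t'] gamma_crit_bounds[of k] by (auto simp: x_def)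
  show "rGamma x = inverse t"
    using f_inv_into_f[OF t'] by (simp add: x_def rGamma_inverse_Gamma)
qed

text \<open>Existence of the boundary limits and absolute integrability are asserted explicitly,
  since \<open>Lim\<close> is arbitrary for a divergent family and \<open>integral\<close> is 0 for
  a function that is not integrable. The value of the density at 0 affects a single point
  only.\<close>

theorem corollary4p7:
  fixes k :: nat and a b :: real and I J :: "real set"
  assumes "even k"
  defines "a \<equiv> Gamma (gamma_crit (Suc k))" and "b \<equiv> Gamma (gamma_crit k)"
  defines "I \<equiv> {gamma_crit (Suc k)<..<- real k} \<union> {- real k<..<gamma_crit k}"
    and "J \<equiv> {..<a} \<union> {b<..}"
  shows "bij_betw Gamma I J \<and>
    (\<forall>s\<in>{-b..-a} - {0}.
       ((\<lambda>y. gamma_branch (int k) (Complex s y)) \<longlongrightarrow> gamma_branch_bdry (int k) s) (at_right 0)) \<and>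
    (\<exists>e. e holomorphic_on (- complex_of_real ` {a..b}) \<and>
      (\<forall>t\<in>J. e (complex_of_real t) = complex_of_real (inv_into I Gamma t)) \<and>
      (\<forall>z\<in>- complex_of_real ` {a..b}.
         (\<lambda>t. complex_of_real (gamma_density (int k) (- t)) / (z - complex_of_real t))
           absolutely_integrable_on {a..b} \<and>
         e z = integral {a..b}
                 (\<lambda>t. complex_of_real (gamma_density (int k) (- t)) / (z - complex_of_real t))
               - of_nat k) \<and>
      (\<forall>z. Im z > 0 \<longrightarrow> Im (e z) < 0))"
proof -
  note k = \<open>even k\<close>
  let ?g = "gamma_branch (int k)"
  let ?d = "\<lambda>t. complex_of_real (gamma_density (int k) (- t))"
  have ab: "a < 0" "b > 0"
    using rGamma_gamma_crit_signs[OF k] by (auto simp: a_def b_def rGamma_inverse_Gamma)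
  have bij: "bij_betw Gamma I J"
    unfolding I_def J_def a_def b_def by (rule bij_betw_Gamma[OF k])
  have bdry: "((\<lambda>y. ?g (Complex s y)) \<longlongrightarrow> gamma_branch_bdry (int k) s) (at_right 0)"
    if "s \<in> {-b..-a} - {0}" for s
    using tendsto_gamma_branch_bdry[OF k] that by (auto simp: a_def b_def)
  have bdryJ: "((\<lambda>y. ?g (Complex (- t) y)) \<longlongrightarrow> of_real (inv_into I Gamma t)) (at_right 0)"
    if "t \<in> J" for t
  proof -
    have "t \<noteq> 0" using that ab by (auto simp: J_def)
    with inv_into_Gamma[OF k, of t] show ?thesis
      using tendsto_gamma_branch_regular[OF k, of "inv_into I Gamma t" "- t"] that
      by (simp add: I_def J_def a_def b_def)
  qed

  \<comment> \<open>Extension by 0 gives the true boundary function: outside the interval the branch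
    has the real limits found in \<open>bdryJ\<close>.\<close>
  define u where "u = (\<lambda>s. if s \<in> {- b..- a} then Im (gamma_branch_bdry (int k) s) else 0)"
  obtain A B where AB: "A \<ge> 0" "B \<ge> 0" "\<And>z. Im z > 0 \<Longrightarrow> norm (?g z) \<le> A + B / sqrt (norm z)"
    using gamma_branch_norm_le[OF k] by blast
  \<comment> \<open>Adding k removes the limit - k at infinity, as the decay hypothesis requires;
    the constant in the bound grows accordingly.\<close>
  interpret half_plane_boundary "\<lambda>z. ?g z + of_nat k" u "A + real k" B "- b" "- a"
  proof
    show "(\<lambda>z. ?g z + of_nat k) holomorphic_on upper_half_plane"
      by (intro holomorphic_intros holomorphic_on_gamma_branch k)
    show "norm (?g z + of_nat k) \<le> A + real k + B / sqrt (norm z)" if "Im z > 0" for z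
      using AB(3)[OF that] norm_triangle_ineq[of "?g z" "of_nat k"] by simp
    show "\<exists>R. \<forall>z. Im z > 0 \<longrightarrow> norm z \<ge> R \<longrightarrow> norm (?g z + of_nat k) \<le> e" if "e > 0" for e
      using gamma_branch_at_infinity[OF k that] by (metis less_imp_le)
    show "((\<lambda>y. Im (?g (Complex s y) + of_nat k)) \<longlongrightarrow> u s) (at_right 0)" if "s \<noteq> 0" for s
    proof (cases "s \<in> {- b..- a}")
      case True
      then show ?thesis using tendsto_Im[OF bdry[of s]] that by (simp add: u_def)
    next
      case False
      then have "- s \<in> J" by (auto simp: J_def)
      then show ?thesis using tendsto_Im[OF bdryJ[of "- s"]] False by (auto simp: u_def)
    qed
  qed (use ab AB in \<open>auto simp: u_def\<close>)

  have dens: "?d t = of_real (u (- t)) / pi" if "t \<in> {a..b}" for t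
    using that by (simp add: u_def gamma_density_def)
  have dens_int: "?d absolutely_integrable_on {a..b}"
  proof -
    have "(\<lambda>s. of_real (u s) * (1 / complex_of_real pi)) absolutely_integrable_on {- b..- a}"
      by (rule absolutely_integrable_kernel) auto
    then have "(\<lambda>s. of_real (u (- s)) * (1 / complex_of_real pi)) absolutely_integrable_on {a..b}"
      using absolutely_integrable_reflect_real[where f = "\<lambda>s. of_real (u (- s)) * (1 / complex_of_real pi)"
          and a = a and b = b] by simp
    then show ?thesis
      by (rule absolutely_integrable_spike[where S = "{}"]) (auto simp: dens)
  qed
  define e where "e = (\<lambda>z. integral {a..b} (\<lambda>t. ?d t / (z - of_real t)) - of_nat k)"
  have hol_e: "e holomorphic_on (- complex_of_real ` {a..b})"
    unfolding e_def by (intro holomorphic_intros holomorphic_on_Cauchy_transform dens_int)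
  \<comment> \<open>For z below the axis - z lies above it, and the substitution s = - t turns the
    kernel 1 / (s + z) into 1 / (z - t).\<close>
  have e_lower: "e z = ?g (- z)" if "Im z < 0" for z
  proof -
    have "?g (- z) + of_nat k = integral {- b..- a} (\<lambda>s. of_real (u s) / (of_real s - - z)) / pi"
      using representation[of "- z"] that by simp
    also have "\<dots> = integral {- b..- a} (\<lambda>s. (of_real (u (- (- s))) / pi) / (z - of_real (- s)))"
      unfolding integral_divide[symmetric] by (intro integral_cong) (simp add: field_simps)
    also have "\<dots> = integral {a..b} (\<lambda>t. (of_real (u (- t)) / pi) / (z - of_real t))"
      by (rule Henstock_Kurzweil_Integration.integral_reflect_real)
    also have "\<dots> = integral {a..b} (\<lambda>t. ?d t / (z - of_real t))"
      by (intro integral_cong) (simp add: dens)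
    finally show ?thesis by (simp add: e_def algebra_simps)
  qed
  \<comment> \<open>The density is real, so conjugation acts on the kernel alone.\<close>
  have e_cnj: "e (cnj z) = cnj (e z)" for z
    by (simp add: e_def integral_cnj)
  \<comment> \<open>By continuity of e off the segment its value at t is the limit along the
    vertical line from below, where e is given by the branch and the limit is already known.\<close>
  have e_J: "e (of_real t) = of_real (inv_into I Gamma t)" if t: "t \<in> J" for t
  proof (rule tendsto_unique[OF trivial_limit_at_right_real])
    have "of_real t \<in> - complex_of_real ` {a..b}"
      using t by (auto simp: J_def)
    moreover have "open (- complex_of_real ` {a..b})"
      by (intro open_Compl compact_imp_closed compact_continuous_image continuous_intros) auto
    ultimately have "isCont e (of_real t)"
      using holomorphic_on_imp_continuous_on[OF hol_e] continuous_on_eq_continuous_at by blast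
    moreover have "((\<lambda>y. Complex t (- y)) \<longlongrightarrow> Complex t (- 0)) (at_right 0)"
      by (intro tendsto_intros)
    then have "((\<lambda>y. Complex t (- y)) \<longlongrightarrow> of_real t) (at_right 0)"
      by (simp add: complex_of_real_def)
    ultimately show "((\<lambda>y. e (Complex t (- y))) \<longlongrightarrow> e (of_real t)) (at_right 0)"
      by (rule isCont_tendsto_compose)
    have eq: "- Complex t (- y) = Complex (- t) y" for y by (simp add: complex_eq_iff)
    have "\<forall>\<^sub>F y in at_right (0::real). ?g (Complex (- t) y) = e (Complex t (- y))"
      using eventually_at_right_less[of "0::real"] by eventually_elim (simp add: e_lower eq)
    with bdryJ[OF t] show "((\<lambda>y. e (Complex t (- y))) \<longlongrightarrow> of_real (inv_into I Gamma t)) (at_right 0)"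
      by (rule Lim_transform_eventually)
  qed
  \<comment> \<open>The branch takes values in the upper half plane, so Im e is positive below the
    axis, and reflection reverses the sign.\<close>
  have e_Im: "Im (e z) < 0" if "Im z > 0" for z
  proof -
    have "Im (e (cnj z)) > 0"
      using that gamma_branch(1)[OF k, of "- cnj z"] by (simp add: e_lower)
    then show ?thesis by (simp add: e_cnj)
  qed
  have e_int: "(\<lambda>t. ?d t / (z - of_real t)) absolutely_integrable_on {a..b}"
    if "z \<in> - complex_of_real ` {a..b}" for z
  proof -
    have "(\<lambda>t. ?d t * (1 / (z - of_real t))) absolutely_integrable_on {a..b}"
      by (intro absolutely_integrable_mult_continuous dens_int continuous_intros) (use that in auto)
    then show ?thesis by simp
  qed
  show ?thesis
    using bij bdry hol_e e_J e_Im e_int by (auto simp: e_def intro!: exI[of _ e])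
qed

end
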